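(* Let $\tau(u,\beta)$ be the generating function, defined in the context, of weighted numbers of (possibly disconnected) coverings of $\mathbb{P}^1$ all of whose ramifications are simple. Then $$ e^{-u}\,\frac{\partial^2}{\partial u^2}\,\log\tau(u,\beta)\;=\;\frac{\tau(u+\beta,\beta)\;\tau(u-\beta,\beta)}{\tau(u,\beta)^2}. $$
   Context: For $d,b\ge0$ let $\mathrm{Cov}_{d,b}$ denote the weighted number of $d$-fold coverings of $\mathbb{P}^1$, not necessarily connected, which have simple ramification (monodromy a transposition in the symmetric group $S(d)$) over $b$ fixed points of $\mathbb{P}^1$ and no other ramification. Each covering is weighted by the reciprocal of the order of its automorphism group. Equivalently, $\mathrm{Cov}_{d,b}=\frac1{d!}\#\{(g_1,\dots,g_b): g_i\in S(d)\text{ transpositions},\ g_1\cdots g_b=1\}$, with $\mathrm{Cov}_{0,0}=1$ and $\mathrm{Cov}_{0,b}=0$ for $b>0$. Define $$ \tau(u,\beta)=\sum_{d\ge0}\sum_{b\ge0} e^{du}\,\frac{\beta^b}{b!}\,\mathrm{Cov}_{d,b}, $$ regarded as a formal power series in $e^u$ and $\beta$. Here $\tau(u\pm\beta,\beta)$ means that $e^u$ is replaced by $e^{\pm\beta}e^u$, with $e^{\pm\beta}$ expanded as a power series in $\beta$, and $\partial/\partial u$ acts by $\partial e^{du}/\partial u=d\,e^{du}$. (This is the specialization of the double Hurwitz generating function $\tau(P,P',\beta,q)=\sum_{d,b,\mu,\nu}q^d\,\frac{\beta^b}{b!}\,p_\mu p'_\nu\,\mathrm{Cov}_d(C_\mu,C_\nu,C_{(2)},\dots,C_{(2)})$,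 with $b$ copies of the class $C_{(2)}$ of transpositions and monodromies $C_\mu,C_\nu$ over $0,\infty$, to $p_k=p'_k=0$ for all $k\ge2$, with $u=\log(q\,p_1\,p'_1)$.) *)

theory Defs
  imports
    "HOL-Computational_Algebra.Formal_Laurent_Series"
    "HOL-Combinatorics.Permutations"
begin

definition transpositions :: "nat \<Rightarrow> (nat \<Rightarrow> nat) set" where
  "transpositions d =
     {transpose i j | i j. i \<in> {1..d} \<and> j \<in> {1..d} \<and> i \<noteq> j}"

definition simple_monodromies :: "nat \<Rightarrow> nat \<Rightarrow> (nat \<Rightarrow> nat) list set" where
  "simple_monodromies d b =
     {gs. length gs = b \<and> set gs \<subseteq> transpositions d \<and> foldr (\<circ>) gs id = id}"

(* A covering with b labelled simple branch points is encoded by its monodromy tuple; the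
   isomorphism classes are the S(d)-orbits under simultaneous conjugation, so weighting each by
   1/|Aut| amounts to dividing the number of tuples by d!. *)
definition Cov :: "nat \<Rightarrow> nat \<Rightarrow> rat" where
  "Cov d b = of_nat (card (simple_monodromies d b)) / fact d"

(* The type rat fps fps is Q[[beta]][[q]] with q = exp u: the outer index is the exponent d of
   exp (d u), the inner index is the exponent of beta. *)
definition tau :: "rat fps fps" where
  "tau = Abs_fps (\<lambda>d. Abs_fps (\<lambda>b. Cov d b / fact b))"

(* f(u + c beta, beta), i.e. q replaced by exp(c beta) q. *)
definition shift_u :: "rat \<Rightarrow> rat fps fps \<Rightarrow> rat fps fps" where
  "shift_u c f = f oo (fps_const (fps_exp c) * fps_X)"

definition deriv_u :: "rat fps fps \<Rightarrow> rat fps fps" where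
  "deriv_u f = Abs_fps (\<lambda>d. of_nat d * fps_nth f d)"

(* The library series fps_ln 1 is log(1 + X); its rational coefficients are embedded in Q[[beta]].
   The composition is the logarithm only for f with q-constant term 1. *)
definition log_series :: "rat fps fps \<Rightarrow> rat fps fps" where
  "log_series f = Abs_fps (\<lambda>n. fps_const (fps_nth (fps_ln 1) n)) oo (f - 1)"

lemma Cov_0: "Cov 0 b = (if b = 0 then 1 else 0)"
proof -
  have "simple_monodromies 0 b = (if b = 0 then {[]} else {})"
    by (auto simp: simple_monodromies_def transpositions_def)
  then show ?thesis
    by (simp add: Cov_def)
qed

(* By the next two lemmas the total operations have their intended meaning here: tau is in the domain
   of log_series, and dividing by tau^2 is division by a unit of Q[[beta]][[q]]. *)
lemma tau_nth_0: "fps_nth tau 0 = 1"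
  by (rule fps_ext) (simp add: tau_def Cov_0)

lemma divide_tau_mult: "f / tau\<^sup>2 * tau\<^sup>2 = f"
proof -
  have g0: "fps_nth (tau\<^sup>2) 0 = 1"
    by (simp add: power2_eq_square tau_nth_0)
  have sub: "subdegree tau = 0"
    by (simp add: subdegree_eq_0_iff tau_nth_0)
  have "inverse (1 :: rat fps) * fps_nth (tau\<^sup>2) 0 = 1"
    by (simp add: g0)
  then have "fps_nth (tau\<^sup>2) 0 * inverse (fps_nth (tau\<^sup>2) 0) = 1"
    by (simp add: g0)
  then have "tau\<^sup>2 * inverse (tau\<^sup>2) = 1"
    unfolding fps_inverse_def by (rule fps_right_inverse)
  then show ?thesis
    by (simp add: fps_divide_def sub mult.assoc mult.commute[of "inverse _"])
qed

end

theory Submission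
  imports Defs "Jordan_Normal_Form.Determinant" "HOL-Library.Poly_Mapping"
begin

text \<open>Multiplying by a transposition acts diagonally on class functions once these are written as
  symmetric polynomials in \<^term>\<open>N\<close> variables and multiplied by the Vandermonde polynomial; reading off
  the multiplicity of the identity gives
  $N!\,\mathrm{Cov}_{d,b} = \sum_l k(l)^2 c(l)^b$, where $l$ runs over exponent vectors,
  $k(l) = \prod_{i<j}(l_i - l_j) / \prod_i l_i!$ and $c$ is the content sum. Since $c$ is a sum of
  one-variable quadratic terms, the generating function of the right-hand side is a Hankel
  determinant of moments $m_{i+j}$ with $m_{k+1} = \partial_u m_k$ (Andreief), and
  the Desnanot-Jacobi identity gives $\tau_N \tau_N'' - (\tau_N')^2 = \tau_{N+1} \tau_{N-1}$ for
  these determinants. Changing $N$ in the weights shifts $u$ by $\pm\beta$, and each coefficient of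
  the determinants agrees with that of \<^term>\<open>tau\<close>, up to common factors, once $N$ is large.\<close>

unbundle no m_inv_syntax

subsection \<open>Colourings fixed by a permutation\<close>

text \<open>No representation is constructed: the coefficients \<open>alt_coef d N g l\<close> stand
  in for the irreducible characters, and only two of their properties enter. The sum over
  transpositions multiplies them by a scalar, and for N \<ge> d their sum over l weighted by
  \<open>kern\<close> vanishes unless g is the identity. Exponent vectors stay unsorted because a
  free sum over all entries is what Andreief's identity turns into a determinant; the price is a
  factor N!.

  The quadratic term a(a + 1 - 2N)/2 of the content sum depends on the number of variables, whereas
  the three determinants in the bilinear identity must share one family of moments. So N is frozen
  in the weights and the size n varies. The exponent then changes by (n - N)a, and the entries a add
  up to d + n(n - 1)/2, which gives the factor exp((n - N) d \<beta>) and a constant; n = N + 1 and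
  n = N - 1 are the two shifts. The factor e^u has a similar origin: the determinant of size n
  starts in degree n(n - 1)/2, and the second difference of these degrees is 1.\<close>

definition colourings :: "nat \<Rightarrow> nat \<Rightarrow> (nat \<Rightarrow> nat) set" where
  "colourings d N = {1..d} \<rightarrow>\<^sub>E {..<N}"

text \<open>Fixed means constant on the cycles of \<open>g\<close>, so the monomials of these
  colourings add up to the power-sum symmetric polynomial of the cycle type of
  \<open>g\<close>.\<close>

definition fixed_colourings :: "nat \<Rightarrow> nat \<Rightarrow> (nat \<Rightarrow> nat) \<Rightarrow> (nat \<Rightarrow> nat) set" where
  "fixed_colourings d N g = {c \<in> colourings d N. c \<circ> g = c}"

definition weight :: "nat \<Rightarrow> (nat \<Rightarrow> nat) \<Rightarrow> nat \<Rightarrow> nat" where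
  "weight d c p = card {i \<in> {1..d}. c i = p}"

lemma finite_colourings [simp]: "finite (colourings d N)"
  by (auto simp: colourings_def intro!: finite_PiE)

lemma finite_fixed_colourings [simp]: "finite (fixed_colourings d N g)"
  by (simp add: fixed_colourings_def)

lemma colouring_range: "c \<in> colourings d N \<Longrightarrow> i \<in> {1..d} \<Longrightarrow> c i < N"
  by (auto simp: colourings_def PiE_iff)

lemma colourings_fun_upd:
  "c \<in> colourings d N \<Longrightarrow> i \<in> {1..d} \<Longrightarrow> p < N \<Longrightarrow> c(i := p) \<in> colourings d N"
  by (auto simp: colourings_def PiE_iff extensional_def)

lemma prod_colouring:
  fixes x :: "nat \<Rightarrow> 'a::comm_monoid_mult"
  assumes "c \<in> colourings d N"
  shows "(\<Prod>i\<in>{1..d}. x (c i)) = (\<Prod>p<N. x p ^ weight d c p)"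
proof -
  have "(\<Prod>i\<in>{1..d}. x (c i)) = (\<Prod>p<N. \<Prod>i\<in>{i\<in>{1..d}. c i = p}. x (c i))"
    using colouring_range[OF assms] by (intro prod.group[symmetric]) auto
  also have "\<dots> = (\<Prod>p<N. x p ^ weight d c p)"
    by (simp add: weight_def)
  finally show ?thesis .
qed

lemma sum_weight:
  assumes "c \<in> colourings d N"
  shows "(\<Sum>p<N. weight d c p) = d"
proof -
  have "(\<Sum>i\<in>{1..d}. 1) = (\<Sum>p<N. \<Sum>i\<in>{i\<in>{1..d}. c i = p}. 1::nat)"
    using colouring_range[OF assms] by (intro sum.group[symmetric]) auto
  then show ?thesis
    by (simp add: weight_def)
qed

lemma prod_colouring_upd:
  fixes x :: "nat \<Rightarrow> 'a::comm_monoid_mult" and d :: nat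
  assumes "j \<in> {1..d}" "c j = p"
  shows "x q * (\<Prod>i\<in>{1..d}. x (c i)) = x p * (\<Prod>i\<in>{1..d}. x ((c(j := q)) i))"
proof -
  have "(\<Prod>i\<in>{1..d}. x (c i)) = x p * (\<Prod>i\<in>{1..d}-{j}. x (c i))"
    using assms by (subst prod.remove[of _ j]) auto
  moreover have "(\<Prod>i\<in>{1..d}. x ((c(j := q)) i)) = x q * (\<Prod>i\<in>{1..d}-{j}. x (c i))"
    using assms by (subst prod.remove[of _ j]) (auto intro!: arg_cong2[where f="(*)"] prod.cong)
  ultimately show ?thesis
    by (simp only: mult_ac)
qed

text \<open>The trace of $E_{pq} E_{qp}$ composed with the permutation \<^term>\<open>h\<close> on a weight space of
  $(\mathbb{C}^N)^{\otimes d}$ is a sum over \<open>recolourings p q\<close>; its cyclicity yields \<open>swaps_relation\<close>.\<close>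

locale colour_swaps =
  fixes d N :: nat and h :: "nat \<Rightarrow> nat" and x :: "nat \<Rightarrow> 'a::comm_ring_1"
  assumes h: "h permutes {1..d}"
begin

definition mono :: "(nat \<Rightarrow> nat) \<Rightarrow> 'a" where
  "mono c = (\<Prod>i\<in>{1..d}. x (c i))"

text \<open>This is \<open>x p\<close> times the partial derivative in \<open>x p\<close> of the
  power sum of \<open>h\<close>, written out on monomials.\<close>

definition euler :: "nat \<Rightarrow> 'a" where
  "euler p = (\<Sum>c\<in>fixed_colourings d N h. of_nat (weight d c p) * mono c)"

definition swaps :: "nat \<Rightarrow> nat \<Rightarrow> 'a" where
  "swaps p q = (\<Sum>(c,i,j)\<in>{(c,i,j) \<in> colourings d N \<times> {1..d} \<times> {1..d}.
      i \<noteq> j \<and> c i = p \<and> c j = q \<and> c \<circ> transpose i j = c \<circ> h}. mono c)"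

definition recolourings :: "nat \<Rightarrow> nat \<Rightarrow> ((nat \<Rightarrow> nat) \<times> nat \<times> nat) set" where
  "recolourings p q = {(c,i,j) \<in> colourings d N \<times> {1..d} \<times> {1..d}.
      c j = p \<and> c (h i) = p \<and> c(j := q) = (c \<circ> h)(i := q)}"

lemma finite_triples [simp]: "finite {(c,i,j) \<in> colourings d N \<times> {1..d} \<times> {1..d}. P c i j}"
  by (rule finite_subset[of _ "colourings d N \<times> {1..d} \<times> {1..d}"]) auto

lemma finite_recolourings [simp]: "finite (recolourings p q)"
  unfolding recolourings_def by (rule finite_triples)

lemma h_in: "h i \<in> {1..d} \<longleftrightarrow> i \<in> {1..d}"
  using h by (rule permutes_in_image)

lemma inv_h_in: "inv h i \<in> {1..d} \<longleftrightarrow> i \<in> {1..d}"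
  using permutes_inv[OF h] by (rule permutes_in_image)

lemma h_inv [simp]: "h (inv h i) = i" "inv h (h i) = i"
  using permutes_inverses[OF h] by auto

lemma h_eq [simp]: "h i = h j \<longleftrightarrow> i = j"
  by (metis h_inv(2))

text \<open>Cyclicity of the trace makes the intermediate colouring \<open>c(j := q)\<close> the
  starting one. Seen from there, the colour q has to be changed back to p, at \<open>i\<close> in
  the colouring itself and at \<open>inv h j\<close> in its permuted copy.\<close>

lemma recolourings_forward:
  assumes "(c,i,j) \<in> recolourings p q" "q < N"
  shows "(c(j := q), inv h j, i) \<in> recolourings q p"
proof -
  from assms(1) have c: "c \<in> colourings d N" "i \<in> {1..d}" "j \<in> {1..d}" "c j = p" "c (h i) = p"
    and e: "c(j := q) = (c \<circ> h)(i := q)"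
    by (auto simp: recolourings_def)
  have "(c(j := q))(i := p) = (c \<circ> h)(i := p)"
    unfolding e by simp
  also have "\<dots> = c \<circ> h"
    using c by (auto simp: fun_eq_iff)
  also have "\<dots> = ((c(j := q)) \<circ> h)(inv h j := p)"
    using c by (auto simp: fun_eq_iff)
  finally have "(c(j := q))(i := p) = ((c(j := q)) \<circ> h)(inv h j := p)" .
  moreover have "(c(j := q)) i = q"
    unfolding e by simp
  ultimately show ?thesis
    using c colourings_fun_upd[OF c(1,3) assms(2)] inv_h_in[of j]
    by (simp add: recolourings_def del: atLeastAtMost_iff One_nat_def)
qed

lemma recolourings_backward:
  assumes "(c,i,j) \<in> recolourings q p" "p < N"
  shows "(c(h i := p), j, h i) \<in> recolourings p q"
proof -
  from assms(1) have c: "c \<in> colourings d N" "i \<in> {1..d}" "j \<in> {1..d}" "c j = q" "c (h i) = q"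
    and e: "c(j := p) = (c \<circ> h)(i := p)"
    by (auto simp: recolourings_def)
  have 1: "c(h i := p) \<circ> h = (c \<circ> h)(i := p)"
    by (auto simp: fun_eq_iff)
  have "(c(h i := p))(h i := q) = c"
    using c by (auto simp: fun_eq_iff)
  also have "\<dots> = (c(j := p))(j := q)"
    using c by (auto simp: fun_eq_iff)
  also have "\<dots> = (c(h i := p) \<circ> h)(j := q)"
    unfolding 1 e ..
  finally have "(c(h i := p))(h i := q) = (c(h i := p) \<circ> h)(j := q)" .
  moreover have "(c(h i := p)) (h j) = p"
    using fun_cong[OF 1, of j] fun_cong[OF e, of j] by simp
  ultimately show ?thesis
    using c colourings_fun_upd[OF c(1) _ assms(2), of "h i"] h_in[of i]
    by (simp add: recolourings_def del: atLeastAtMost_iff One_nat_def)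
qed

text \<open>Corresponding colourings differ in one letter, p against q, so their monomials become
  equal after cross-multiplication by \<open>x q\<close> and \<open>x p\<close>.\<close>

lemma sum_recolourings_swap:
  assumes "p < N" "q < N"
  shows "x q * (\<Sum>(c,i,j)\<in>recolourings p q. mono c) = x p * (\<Sum>(c,i,j)\<in>recolourings q p. mono c)"
  unfolding sum_distrib_left
proof (rule sum.reindex_bij_witness[where
      i = "\<lambda>(c,i,j). (c(h i := p), j, h i)" and j = "\<lambda>(c,i,j). (c(j := q), inv h j, i)"])
  fix a assume a: "a \<in> recolourings p q"
  obtain c i j where [simp]: "a = (c,i,j)" by (cases a)
  have c: "j \<in> {1..d}" "c j = p" using a by (auto simp: recolourings_def)
  show "(case case a of (c, i, j) \<Rightarrow> (c(j := q), inv h j, i) of (c, i, j) \<Rightarrow> (c(h i := p), j, h i)) = a"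
    using c by (auto simp: fun_eq_iff)
  show "(case a of (c, i, j) \<Rightarrow> (c(j := q), inv h j, i)) \<in> recolourings q p"
    using recolourings_forward[of c i j p q] a assms by simp
  show "x p * (case case a of (c, i, j) \<Rightarrow> (c(j := q), inv h j, i) of (c, i, j) \<Rightarrow> mono c) =
      x q * (case a of (c, i, j) \<Rightarrow> mono c)"
    using prod_colouring_upd[where x = x and c = c and q = q, OF c] by (simp add: mono_def)
next
  fix a assume a: "a \<in> recolourings q p"
  obtain c i j where [simp]: "a = (c,i,j)" by (cases a)
  have c: "c (h i) = q" using a by (auto simp: recolourings_def)
  show "(case case a of (c, i, j) \<Rightarrow> (c(h i := p), j, h i) of (c, i, j) \<Rightarrow> (c(j := q), inv h j, i)) = a"
    using c by (auto simp: fun_eq_iff)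
  show "(case a of (c, i, j) \<Rightarrow> (c(h i := p), j, h i)) \<in> recolourings p q"
    using recolourings_backward[of c i j q p] a assms by simp
qed

text \<open>If i = j, the two recolourings cancel and \<open>c\<close> is fixed by \<open>h\<close>,
  with a marked position of colour p; this is the Euler term. If i and j differ, the recolourings
  say that \<open>c\<close> and \<open>c \<circ> h\<close> differ by the transposition of i and
  j.\<close>

lemma sum_recolourings:
  assumes "p \<noteq> q"
  shows "(\<Sum>(c,i,j)\<in>recolourings p q. mono c) = euler p + swaps q p"
proof -
  let ?A = "SIGMA c:fixed_colourings d N h. {i\<in>{1..d}. c i = p}"
  let ?f = "\<lambda>(c,i). (c,i,i)"
  let ?B = "{(c,i,j) \<in> colourings d N \<times> {1..d} \<times> {1..d}.
      i \<noteq> j \<and> c i = q \<and> c j = p \<and> c \<circ> transpose i j = c \<circ> h}"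
  have "recolourings p q = ?f ` ?A \<union> ?B" (is "?L = ?R")
  proof (intro Set.set_eqI)
    fix a :: "(nat \<Rightarrow> nat) \<times> nat \<times> nat"
    obtain c i j where [simp]: "a = (c,i,j)" by (cases a)
    show "a \<in> ?L \<longleftrightarrow> a \<in> ?R"
    proof (cases "i = j")
      case True
      have "c(i := q) = (c \<circ> h)(i := q) \<longleftrightarrow> c \<circ> h = c" if "c i = p" "c (h i) = p"
        using that by (auto simp: fun_eq_iff)
      moreover have "c (h i) = p" if "c i = p" "c \<circ> h = c"
        using that by (metis comp_apply)
      ultimately show ?thesis
        using True by (auto simp: recolourings_def fixed_colourings_def image_iff)
    next
      case False
      have "c j = p \<and> c (h i) = p \<and> c(j := q) = (c \<circ> h)(i := q) \<longleftrightarrow>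
          c i = q \<and> c j = p \<and> c \<circ> transpose i j = c \<circ> h" (is "?X \<longleftrightarrow> ?Y")
      proof
        assume X: ?X
        then have e: "c(j := q) = (c \<circ> h)(i := q)" by blast
        have Xk: "(c(j := q)) k = ((c \<circ> h)(i := q)) k" for k by (rule fun_cong[OF e])
        have "c i = q" "c (h j) = q"
          using Xk[of i] Xk[of j] False by auto
        moreover have "c (transpose i j k) = c (h k)" for k
        proof -
          consider "k = i" | "k = j" | "k \<noteq> i" "k \<noteq> j" by blast
          then show ?thesis
          proof cases
            case 1
            then show ?thesis using X by (metis transpose_apply_first)
          next
            case 2
            then show ?thesis using calculation by (metis transpose_apply_second)
          next
            case 3
            then show ?thesis using Xk[of k] by (simp add: transpose_apply_other)
          qed
        qed
        ultimately show ?Y using X by auto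
      next
        assume Y: ?Y
        have Yk: "c (transpose i j k) = c (h k)" for k
          using Y by (metis comp_apply)
        have "c (h i) = p" "c (h j) = q"
          using Yk[of i] Yk[of j] Y by auto
        moreover have "(c(j := q)) k = ((c \<circ> h)(i := q)) k" for k
          using Yk[of k] Y calculation False by (cases "k = i"; cases "k = j") auto
        ultimately show ?X using Y by auto
      qed
      then show ?thesis
        using False by (auto simp: recolourings_def image_iff)
    qed
  qed
  moreover have "?f ` ?A \<inter> ?B = {}" by auto
  moreover have "finite ?A" by auto
  moreover have "finite ?B" by (rule finite_triples)
  ultimately have "(\<Sum>(c,i,j)\<in>recolourings p q. mono c) =
      (\<Sum>(c,i,j)\<in>?f ` ?A. mono c) + (\<Sum>(c,i,j)\<in>?B. mono c)"
    by (simp add: sum.union_disjoint)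
  also have "(\<Sum>(c,i,j)\<in>?f ` ?A. mono c) = (\<Sum>(c,i)\<in>?A. mono c)"
    by (subst sum.reindex) (auto simp: inj_on_def intro!: sum.cong)
  also have "\<dots> = euler p"
    by (subst sum.Sigma[symmetric]) (auto simp: euler_def weight_def)
  finally show ?thesis by (simp only: swaps_def)
qed

lemma swaps_commute: "swaps p q = swaps q p"
  unfolding swaps_def
  by (rule sum.reindex_bij_witness[where i = "\<lambda>(c,i,j). (c,j,i)" and j = "\<lambda>(c,i,j). (c,j,i)"])
    (auto simp: transpose_commute)

text \<open>Two expansions of the same trace, subtracted. The part of the transposition sum that
  exchanges two different colours becomes a divided difference of first-order operators: the
  off-diagonal part of the cut-and-join operator, in the variables \<open>x\<close> instead of power
  sums.\<close>

lemma swaps_relation: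
  assumes "p < N" "q < N" "p \<noteq> q"
  shows "(x p - x q) * swaps p q = x q * euler p - x p * euler q"
  using sum_recolourings_swap[OF assms(1,2)] sum_recolourings[OF assms(3)]
    sum_recolourings[OF assms(3)[symmetric]] swaps_commute[of p q]
  by (simp add: algebra_simps)

text \<open>A transposition inside one colour class does not change \<open>c\<close>, so these pairs
  only multiply each colouring fixed by \<open>h\<close> by the number of ordered pairs of equal
  colour. All other pairs are sorted by their two colours.\<close>

lemma sum_transposed:
  "(\<Sum>(i,j)\<in>{(i,j)\<in>{1..d}\<times>{1..d}. i \<noteq> j}. \<Sum>c\<in>{c\<in>colourings d N. c \<circ> transpose i j = c \<circ> h}. mono c) =
    (\<Sum>c\<in>fixed_colourings d N h. of_nat (\<Sum>p<N. weight d c p * (weight d c p - 1)) * mono c) +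
    (\<Sum>p<N. \<Sum>q\<in>{..<N}-{p}. swaps p q)"
proof -
  let ?P = "{(i,j)\<in>{1..d}\<times>{1..d}. i \<noteq> j}"
  let ?T = "\<lambda>R. {(c,i,j) \<in> colourings d N \<times> {1..d} \<times> {1..d}. i \<noteq> j \<and> R (c i) (c j) \<and> c \<circ> transpose i j = c \<circ> h}"
  let ?f = "\<lambda>(c,i,j). mono c"
  have fP: "finite ?P"
    by (rule finite_subset[of _ "{1..d}\<times>{1..d}"]) auto
  have "(\<Sum>(i,j)\<in>?P. \<Sum>c\<in>{c\<in>colourings d N. c \<circ> transpose i j = c \<circ> h}. mono c)
      = (\<Sum>(a,c)\<in>(SIGMA a:?P. {c\<in>colourings d N. c \<circ> transpose (fst a) (snd a) = c \<circ> h}). mono c)"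
    unfolding case_prod_unfold by (rule sum.Sigma[unfolded case_prod_unfold]) (use fP in \<open>auto simp: case_prod_unfold\<close>)
  also have "\<dots> = sum ?f (?T (\<lambda>_ _. True))"
    by (rule sum.reindex_bij_witness[where i = "\<lambda>(c,i,j). ((i,j),c)" and j = "\<lambda>((i,j),c). (c,i,j)"]) auto
  also have "?T (\<lambda>_ _. True) = ?T (=) \<union> ?T (\<noteq>)"
    by blast
  also have "sum ?f (?T (=) \<union> ?T (\<noteq>)) = sum ?f (?T (=)) + sum ?f (?T (\<noteq>))"
    by (rule sum.union_disjoint[OF finite_triples finite_triples]) blast
  also have "sum ?f (?T (=)) =
      (\<Sum>c\<in>fixed_colourings d N h. of_nat (\<Sum>p<N. weight d c p * (weight d c p - 1)) * mono c)"
  proof -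
    let ?E = "\<lambda>c. {(i,j)\<in>{1..d}\<times>{1..d}. i \<noteq> j \<and> c i = c j}"
    have fE: "finite (?E c)" for c :: "nat \<Rightarrow> nat"
      by (rule finite_subset[OF _ fP]) auto
    have "c \<circ> transpose i j = c" if "c i = c j" for c :: "nat \<Rightarrow> nat" and i j
      using that by (auto simp: fun_eq_iff transpose_def)
    then have "?T (=) = (SIGMA c:fixed_colourings d N h. ?E c)"
      by (auto simp: fixed_colourings_def)
    then have "sum ?f (?T (=)) = (\<Sum>(c,a)\<in>(SIGMA c:fixed_colourings d N h. ?E c). mono c)"
      by (simp add: case_prod_unfold)
    also have "\<dots> = (\<Sum>c\<in>fixed_colourings d N h. \<Sum>a\<in>?E c. mono c)"
      by (rule sum.Sigma[symmetric]) (use fE in auto)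
    also have "\<dots> = (\<Sum>c\<in>fixed_colourings d N h. of_nat (card (?E c)) * mono c)"
      by simp
    finally have "sum ?f (?T (=)) = \<dots>" .
    moreover have "card (?E c) = (\<Sum>p<N. weight d c p * (weight d c p - 1))"
      if c: "c \<in> colourings d N" for c
    proof -
      let ?W = "\<lambda>p. {i\<in>{1..d}. c i = p}"
      have "card (?E c) = card (\<Union>p\<in>{..<N}. SIGMA i:?W p. ?W p - {i})"
      proof (rule arg_cong[where f = card], rule Set.set_eqI)
        fix a
        show "a \<in> ?E c \<longleftrightarrow> a \<in> (\<Union>p\<in>{..<N}. SIGMA i:?W p. ?W p - {i})"
          using colouring_range[OF c, of "fst a"] by (cases a) auto
      qed
      also have "\<dots> = (\<Sum>p<N. card (SIGMA i:?W p. ?W p - {i}))"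
        by (rule card_UN_disjoint) auto
      also have "\<dots> = (\<Sum>p<N. weight d c p * (weight d c p - 1))"
      proof (rule sum.cong[OF refl])
        fix p
        have "card (SIGMA i:?W p. ?W p - {i}) = (\<Sum>i\<in>?W p. card (?W p - {i}))"
          by (rule card_SigmaI) auto
        also have "\<dots> = (\<Sum>i\<in>?W p. weight d c p - 1)"
          unfolding weight_def by (intro sum.cong refl card_Diff_singleton)
        also have "\<dots> = weight d c p * (weight d c p - 1)"
          by (simp add: weight_def)
        finally show "card (SIGMA i:?W p. ?W p - {i}) = weight d c p * (weight d c p - 1)" .
      qed
      finally show ?thesis .
    qed
    ultimately show ?thesis
      by (simp add: fixed_colourings_def)
  qed
  also have "sum ?f (?T (\<noteq>)) = (\<Sum>p<N. \<Sum>q\<in>{..<N}-{p}. swaps p q)"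
  proof -
    let ?S = "SIGMA p:{..<N}. {..<N}-{p}"
    let ?h = "\<lambda>(c::nat\<Rightarrow>nat,i::nat,j::nat). (c i, c j)"
    have "(\<Sum>p<N. \<Sum>q\<in>{..<N}-{p}. swaps p q) = (\<Sum>(p,q)\<in>?S. swaps p q)"
      by (rule sum.Sigma) auto
    also have "\<dots> = (\<Sum>a\<in>?S. sum ?f {t\<in>?T (\<noteq>). ?h t = a})"
      unfolding swaps_def case_prod_unfold
      by (intro sum.cong refl) auto
    also have "\<dots> = sum ?f (?T (\<noteq>))"
      by (rule sum.group[OF finite_triples]) (auto simp: colouring_range)
    finally show ?thesis by simp
  qed
  finally show ?thesis .
qed

end

subsection \<open>The Vandermonde polynomial and its Euler derivatives\<close>

definition vand :: "nat \<Rightarrow> (nat \<Rightarrow> 'a::comm_ring_1) \<Rightarrow> 'a" where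
  "vand N x = (\<Sum>s | s permutes {..<N}. of_int (sign s) * (\<Prod>i<N. x i ^ (N - 1 - s i)))"

text \<open>The Euler derivative, \<open>x p\<close> times the partial derivative in
  \<open>x p\<close>, of \<open>vand N x\<close>, taken term by term.\<close>

definition vand_euler :: "nat \<Rightarrow> (nat \<Rightarrow> 'a::comm_ring_1) \<Rightarrow> nat \<Rightarrow> 'a" where
  "vand_euler N x p = (\<Sum>s | s permutes {..<N}.
     of_int (sign s) * (of_nat (N - 1 - s p) * (\<Prod>i<N. x i ^ (N - 1 - s i))))"

lemma sum_sign_swap:
  fixes f :: "(nat \<Rightarrow> nat) \<Rightarrow> 'a::comm_ring_1"
  assumes "p \<noteq> q" "p \<in> S" "q \<in> S" "finite S"
  shows "(\<Sum>s | s permutes S. of_int (sign s) * f (s \<circ> transpose p q)) =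
    - (\<Sum>s | s permutes S. of_int (sign s) * f s)"
proof -
  have "(\<Sum>s | s permutes S. of_int (sign s) * f (s \<circ> transpose p q)) =
      (\<Sum>s | s permutes S. - (of_int (sign s) * f s))"
  proof (rule sum.reindex_bij_witness[where i = "\<lambda>s. s \<circ> transpose p q" and j = "\<lambda>s. s \<circ> transpose p q"])
    fix s assume "s \<in> {s. s permutes S}"
    then have s: "permutation s"
      using permutation_permutes assms(4) by blast
    show "- (of_int (sign (s \<circ> transpose p q)) * f (s \<circ> transpose p q)) =
        of_int (sign s) * f (s \<circ> transpose p q)"
      using s assms(1) by (simp add: sign_compose permutation_swap_id sign_swap_id)
  qed (use assms in \<open>auto simp: comp_assoc intro: permutes_compose permutes_swap_id\<close>)
  then show ?thesis by (simp add: sum_negf)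
qed

lemma vand_eq_0:
  fixes x :: "nat \<Rightarrow> 'a::{idom,ring_char_0}"
  assumes "p < N" "q < N" "p \<noteq> q" "x p = x q"
  shows "vand N x = 0"
proof -
  have x: "x (transpose p q i) = x i" for i
    using assms(4) by (auto simp: transpose_def)
  have "(\<Prod>i<N. x i ^ (N - 1 - (s \<circ> transpose p q) i)) = (\<Prod>i<N. x i ^ (N - 1 - s i))" for s
  proof -
    have "(\<Prod>i<N. x i ^ (N - 1 - s i)) = (\<Prod>i<N. x (transpose p q i) ^ (N - 1 - s (transpose p q i)))"
      by (rule prod.reindex_bij_betw[symmetric])
        (use permutes_imp_bij[OF permutes_swap_id] assms in auto)
    then show ?thesis by (simp add: x)
  qed
  then have "vand N x = - vand N x"
    using sum_sign_swap[of p q "{..<N}" "\<lambda>s. \<Prod>i<N. x i ^ (N - 1 - s i)"] assms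
    by (simp add: vand_def)
  then show ?thesis by (simp add: eq_neg_iff_add_eq_0 flip: mult_2)
qed

lemma poly_eq_smult_prod_roots:
  fixes f :: "'a::idom poly"
  assumes "finite S" "degree f \<le> card S" "\<And>a. a \<in> S \<Longrightarrow> poly f a = 0"
  shows "\<exists>g. f = Polynomial.smult g (\<Prod>a\<in>S. [:- a, 1:])"
  using assms
proof (induction S arbitrary: f)
  case empty
  then show ?case
    by (auto elim!: degree_eq_zeroE)
next
  case (insert a S)
  then have "[:- a, 1:] dvd f" by (simp add: poly_eq_0_iff_dvd)
  then obtain h where h: "f = [:- a, 1:] * h" by (elim dvdE)
  have "degree h \<le> card S"
  proof (cases "h = 0")
    case False
    then have "degree f = Suc (degree h)"
      unfolding h by (subst degree_mult_eq) auto
    then show ?thesis using insert by simp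
  qed auto
  moreover have "poly h b = 0" if "b \<in> S" for b
    using insert.prems(2)[of b] insert.hyps that by (auto simp: h)
  ultimately obtain g where "h = Polynomial.smult g (\<Prod>a\<in>S. [:- a, 1:])"
    using insert.IH by blast
  then show ?case
    using insert.hyps by (auto simp: h)
qed

text \<open>\<open>W p q\<close> is the quotient of the Vandermonde polynomial by
  \<open>x p - x q\<close>, obtained without fractions: in the p-th variable alone the polynomial
  has degree at most N - 1 and vanishes at the N - 1 other values. The last clause is the
  logarithmic derivative of the product formula.\<close>

lemma vand_split:
  fixes x :: "nat \<Rightarrow> 'a::{idom,ring_char_0}"
  assumes inj: "inj_on x {..<N}"
  shows "\<exists>W. (\<forall>p<N. \<forall>q<N. p \<noteq> q \<longrightarrow> vand N x = (x p - x q) * W p q \<and> W q p = - W p q) \<and>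
    (\<forall>p<N. vand_euler N x p = (\<Sum>q\<in>{..<N}-{p}. x p * W p q))"
proof -
  \<comment> \<open>The alternant with its p-th variable left free.\<close>
  define f where "f = (\<lambda>p. \<Sum>s | s permutes {..<N}.
    monom (of_int (sign s) * (\<Prod>i\<in>{..<N}-{p}. x i ^ (N - 1 - s i))) (N - 1 - s p))"
  have split: "(\<Prod>i<N. (x(p := t)) i ^ (N - 1 - s i)) =
      t ^ (N - 1 - s p) * (\<Prod>i\<in>{..<N}-{p}. x i ^ (N - 1 - s i))" if "p < N" for p t s
    using that by (subst prod.remove[of _ p]) (auto intro!: arg_cong2[where f="(*)"] prod.cong)
  have eval: "poly (f p) t = vand N (x(p := t))" if "p < N" for p t
    unfolding f_def vand_def poly_sum poly_monom split[OF that] by (simp only: mult_ac)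
  have "\<exists>g. f p = Polynomial.smult g (\<Prod>q\<in>{..<N}-{p}. [:- x q, 1:])" if p: "p < N" for p
  proof -
    have inj': "inj_on x ({..<N}-{p})"
      using inj by (rule inj_on_subset) auto
    have "degree (f p) \<le> N - 1"
      unfolding f_def by (intro degree_sum_le) (auto intro: finite_permutations order.trans[OF degree_monom_le])
    then have "degree (f p) \<le> card (x ` ({..<N}-{p}))"
      using p by (simp add: card_image[OF inj'])
    moreover have "poly (f p) a = 0" if "a \<in> x ` ({..<N}-{p})" for a
      using that p by (auto simp: eval intro: vand_eq_0)
    ultimately have "\<exists>g. f p = Polynomial.smult g (\<Prod>a\<in>x ` ({..<N}-{p}). [:- a, 1:])"
      by (intro poly_eq_smult_prod_roots) simp_all
    then show ?thesis
      by (auto simp: prod.reindex[OF inj'])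
  qed
  then obtain g where g: "\<And>p. p < N \<Longrightarrow> f p = Polynomial.smult (g p) (\<Prod>q\<in>{..<N}-{p}. [:- x q, 1:])"
    by metis
  define W where "W = (\<lambda>p q. g p * (\<Prod>r\<in>{..<N}-{p}-{q}. x p - x r))"
  have 1: "vand N x = (x p - x q) * W p q" if "p < N" "q < N" "p \<noteq> q" for p q
  proof -
    have "vand N x = poly (f p) (x p)" using that by (simp add: eval)
    also have "\<dots> = g p * (\<Prod>q\<in>{..<N}-{p}. x p - x q)"
      using that by (simp add: g poly_prod)
    also have "\<dots> = (x p - x q) * W p q"
      using that by (subst prod.remove[of _ q]) (auto simp: W_def)
    finally show ?thesis .
  qed
  have 2: "W q p = - W p q" if "p < N" "q < N" "p \<noteq> q" for p q
  proof -
    have "x p - x q \<noteq> 0"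
      using inj_onD[OF inj, of p q] that by auto
    moreover have "(x p - x q) * W q p = (x p - x q) * (- W p q)"
      using 1[of p q] 1[of q p] that by (simp add: algebra_simps)
    ultimately show ?thesis by (metis mult_left_cancel)
  qed
  have 3: "vand_euler N x p = (\<Sum>q\<in>{..<N}-{p}. x p * W p q)" if p: "p < N" for p
  proof -
    have "vand_euler N x p = x p * poly (pderiv (f p)) (x p)"
    proof -
      have k: "x p * (of_nat k * c * x p ^ (k - 1)) = c * (of_nat k * x p ^ k)" for k c
        by (cases k) (simp_all add: mult_ac)
      have ps: "pderiv (sum F S) = (\<Sum>a\<in>S. pderiv (F a))" for F :: "(nat \<Rightarrow> nat) \<Rightarrow> 'a poly" and S
        by (induction S rule: infinite_finite_induct) (auto simp: pderiv_add)
      have "vand_euler N x p = (\<Sum>s | s permutes {..<N}. (of_int (sign s) *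
          (\<Prod>i\<in>{..<N}-{p}. x i ^ (N - 1 - s i))) * (of_nat (N - 1 - s p) * x p ^ (N - 1 - s p)))"
        using split[OF p, of "x p"] by (simp add: vand_euler_def mult_ac)
      also have "\<dots> = x p * poly (pderiv (f p)) (x p)"
        unfolding f_def ps poly_sum pderiv_monom poly_monom sum_distrib_left k ..
      finally show ?thesis .
    qed
    \<comment> \<open>The product rule omits one linear factor at a time, and omitting the factor of
      q leaves \<open>W p q\<close>.\<close>
    also have "poly (pderiv (f p)) (x p) = (\<Sum>q\<in>{..<N}-{p}. W p q)"
      using p by (simp add: g pderiv_smult pderiv_prod poly_sum poly_prod W_def sum_distrib_left pderiv_pCons)
    finally show ?thesis by (simp add: sum_distrib_left)
  qed
  show ?thesis
    by (intro exI[of _ W] conjI allI impI 1 2 3)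
qed

subsection \<open>Transpositions act diagonally on alternants\<close>

text \<open>On exponents w + N - 1 - i the i-th term, less its staircase value, is w^2 - (2i + 1)w,
  which is twice the content sum of a row of length w. Doubling keeps the values integral and
  matches the count of ordered pairs (i, j).\<close>

definition double_content :: "nat \<Rightarrow> (nat \<Rightarrow> nat) \<Rightarrow> int" where
  "double_content N l = (\<Sum>p<N. int (l p) * (int (l p) + 1 - 2 * int N)) - (\<Sum>p<N. int p * (int p + 1 - 2 * int N))"

text \<open>Multiplying \<open>swaps_relation\<close> by \<open>W p q\<close> trades the factor
  \<open>x p - x q\<close> for the Vandermonde polynomial. Antisymmetry of \<open>W\<close> makes
  both terms of the right-hand side contribute equally, hence the 2; and
  \<open>W p q * x q = x p * W p q - vand N x\<close>, summed over the N - 1 values of q, is the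
  coefficient of the Euler term.\<close>

lemma vand_mult_swaps:
  fixes x :: "nat \<Rightarrow> 'a::{idom,ring_char_0}"
  assumes inj: "inj_on x {..<N}" and h: "h permutes {1..d}"
  shows "vand N x * (\<Sum>p<N. \<Sum>q\<in>{..<N}-{p}. colour_swaps.swaps d N h x p q) =
    2 * (\<Sum>p<N. (vand_euler N x p - of_nat (N - 1) * vand N x) * colour_swaps.euler d N h x p)"
proof -
  interpret colour_swaps d N h x using h by unfold_locales
  let ?S = "SIGMA p:{..<N}. {..<N}-{p}"
  obtain W where W: "\<forall>p<N. \<forall>q<N. p \<noteq> q \<longrightarrow> vand N x = (x p - x q) * W p q \<and> W q p = - W p q"
    and W3: "\<forall>p<N. vand_euler N x p = (\<Sum>q\<in>{..<N}-{p}. x p * W p q)"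
    using vand_split[OF inj] by blast
  have W1: "vand N x = (x p - x q) * W p q" and W2: "W q p = - W p q"
    if "p < N" "q < N" "p \<noteq> q" for p q
    using W that by blast+
  have a: "(\<Sum>p<N. \<Sum>q\<in>{..<N}-{p}. W p q * x q * euler p) =
      (\<Sum>p<N. (vand_euler N x p - of_nat (N - 1) * vand N x) * euler p)"
  proof (rule sum.cong[OF refl])
    fix p assume p: "p \<in> {..<N}"
    have "(\<Sum>q\<in>{..<N}-{p}. W p q * x q) = (\<Sum>q\<in>{..<N}-{p}. x p * W p q - vand N x)"
      using p W1[of p] by (intro sum.cong) (auto simp: algebra_simps)
    also have "\<dots> = vand_euler N x p - of_nat (N - 1) * vand N x"
      using p by (simp add: W3 sum_subtractf)
    finally show "(\<Sum>q\<in>{..<N}-{p}. W p q * x q * euler p) =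
        (vand_euler N x p - of_nat (N - 1) * vand N x) * euler p"
      by (simp only: sum_distrib_right[symmetric])
  qed
  have b: "(\<Sum>p<N. \<Sum>q\<in>{..<N}-{p}. W p q * x p * euler q) = - (\<Sum>p<N. \<Sum>q\<in>{..<N}-{p}. W p q * x q * euler p)"
  proof -
    have "(\<Sum>p<N. \<Sum>q\<in>{..<N}-{p}. W p q * x p * euler q) = (\<Sum>(p,q)\<in>?S. W p q * x p * euler q)"
      by (rule sum.Sigma) auto
    also have "\<dots> = (\<Sum>(p,q)\<in>?S. - (W p q * x q * euler p))"
    proof (rule sum.reindex_bij_witness[where i = prod.swap and j = prod.swap])
      fix a assume "a \<in> ?S"
      moreover obtain p q where a: "a = (p, q)" by (cases a)
      ultimately have "W q p = - W p q" by (intro W2) auto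
      then show "(case prod.swap a of (p, q) \<Rightarrow> - (W p q * x q * euler p)) =
          (case a of (p, q) \<Rightarrow> W p q * x p * euler q)"
        by (simp add: a)
    qed auto
    also have "\<dots> = - (\<Sum>(p,q)\<in>?S. W p q * x q * euler p)"
      by (simp add: sum_negf case_prod_unfold)
    also have "(\<Sum>(p,q)\<in>?S. W p q * x q * euler p) = (\<Sum>p<N. \<Sum>q\<in>{..<N}-{p}. W p q * x q * euler p)"
      by (rule sum.Sigma[symmetric]) auto
    finally show ?thesis .
  qed
  have "vand N x * swaps p q = W p q * x q * euler p - W p q * x p * euler q"
    if "p < N" "q < N" "p \<noteq> q" for p q
  proof -
    have "vand N x * swaps p q = W p q * ((x p - x q) * swaps p q)"
      using W1[OF that] by (simp only: mult_ac)
    then show ?thesis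
      unfolding swaps_relation[OF that] by (simp add: algebra_simps)
  qed
  then have "vand N x * (\<Sum>p<N. \<Sum>q\<in>{..<N}-{p}. swaps p q) =
      (\<Sum>p<N. \<Sum>q\<in>{..<N}-{p}. W p q * x q * euler p - W p q * x p * euler q)"
    unfolding sum_distrib_left by (intro sum.cong refl) auto
  also have "\<dots> = 2 * (\<Sum>p<N. \<Sum>q\<in>{..<N}-{p}. W p q * x q * euler p)"
    unfolding sum_subtractf b by simp
  finally show ?thesis unfolding a .
qed

text \<open>The Vandermonde factor decouples the variables. For exponents w from the power sum and e
  from the alternant, equal colours contribute w(w - 1) and different colours 2(e - (N - 1))w. The
  total is (w + e)(w + e + 1 - 2N) - e(e + 1 - 2N), which depends on w + e only, up to the fixed
  staircase sum.\<close>

lemma vand_mult_transposed: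
  fixes x :: "nat \<Rightarrow> 'a::{idom,ring_char_0}"
  assumes inj: "inj_on x {..<N}" and h: "h permutes {1..d}"
  shows "vand N x * (\<Sum>(i,j)\<in>{(i,j)\<in>{1..d}\<times>{1..d}. i \<noteq> j}.
      \<Sum>c\<in>{c\<in>colourings d N. c \<circ> transpose i j = c \<circ> h}. \<Prod>k\<in>{1..d}. x (c k)) =
    (\<Sum>c\<in>fixed_colourings d N h. \<Sum>s | s permutes {..<N}.
      of_int (sign s * double_content N (\<lambda>p. weight d c p + (N - 1 - s p))) *
      (\<Prod>p<N. x p ^ (weight d c p + (N - 1 - s p))))"
proof -
  interpret colour_swaps d N h x using h by unfold_locales
  let ?V = "\<lambda>s. of_int (sign s) * (\<Prod>i<N. x i ^ (N - 1 - s i)) :: 'a"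
  let ?F = "fixed_colourings d N h" and ?P = "{s. s permutes {..<N}}"
  let ?w = "weight d"
  have cont: "double_content N (\<lambda>p. ?w c p + (N - 1 - s p)) =
      int (\<Sum>p<N. ?w c p * (?w c p - 1)) + 2 * (\<Sum>p<N. (int (N - 1 - s p) - int (N - 1)) * int (?w c p))"
    if "s \<in> ?P" for c s
  proof -
    have bij: "bij_betw (\<lambda>p. N - 1 - s p) {..<N} {..<N}"
    proof -
      have "bij_betw (\<lambda>p. N - 1 - p) {..<N} {..<N}"
        by (rule bij_betw_byWitness[where f' = "\<lambda>p. N - 1 - p"]) auto
      with permutes_imp_bij[of s "{..<N}"] that show ?thesis
        by (auto dest: bij_betw_trans simp: comp_def)
    qed
    \<comment> \<open>The staircase is subtracted in the order given by \<open>s\<close>, so that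
      the difference can be taken for each p.\<close>
    have eq: "(\<Sum>p<N. int p * (int p + 1 - 2 * int N)) =
        (\<Sum>p<N. int (N - 1 - s p) * (int (N - 1 - s p) + 1 - 2 * int N))"
      by (rule sum.reindex_bij_betw[OF bij, symmetric])
    have "double_content N (\<lambda>p. ?w c p + (N - 1 - s p)) =
        (\<Sum>p<N. int (?w c p) * (int (?w c p) - 1) + 2 * ((int (N - 1 - s p) - int (N - 1)) * int (?w c p)))"
      unfolding double_content_def eq sum_subtractf[symmetric]
      by (intro sum.cong) (auto simp: algebra_simps of_nat_diff)
    also have "\<dots> = (\<Sum>p<N. int (?w c p * (?w c p - 1)) + 2 * ((int (N - 1 - s p) - int (N - 1)) * int (?w c p)))"
    proof -
      have k: "int k * (int k - 1) = int (k * (k - 1))" for k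
        by (cases k) (auto simp: algebra_simps)
      show ?thesis by (simp only: k)
    qed
    finally show ?thesis
      by (simp add: sum.distrib sum_distrib_left)
  qed
  have "vand N x * (\<Sum>(i,j)\<in>{(i,j)\<in>{1..d}\<times>{1..d}. i \<noteq> j}.
      \<Sum>c\<in>{c\<in>colourings d N. c \<circ> transpose i j = c \<circ> h}. mono c) =
    vand N x * (\<Sum>c\<in>?F. of_nat (\<Sum>p<N. ?w c p * (?w c p - 1)) * mono c) +
    2 * (\<Sum>p<N. (vand_euler N x p - of_nat (N - 1) * vand N x) * euler p)"
    unfolding sum_transposed ring_distribs vand_mult_swaps[OF inj h] ..
  also have "vand N x * (\<Sum>c\<in>?F. of_nat (\<Sum>p<N. ?w c p * (?w c p - 1)) * mono c) =
      (\<Sum>c\<in>?F. \<Sum>s\<in>?P. of_int (int (\<Sum>p<N. ?w c p * (?w c p - 1))) * (?V s * mono c))"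
    unfolding vand_def sum_distrib_left sum_distrib_right
    by (simp add: mult_ac)
  also have "(\<Sum>p<N. (vand_euler N x p - of_nat (N - 1) * vand N x) * euler p) =
      (\<Sum>c\<in>?F. \<Sum>s\<in>?P. of_int (\<Sum>p<N. (int (N - 1 - s p) - int (N - 1)) * int (?w c p)) * (?V s * mono c))"
  proof -
    have e: "(vand_euler N x p - of_nat (N - 1) * vand N x) * euler p =
        (\<Sum>c\<in>?F. \<Sum>s\<in>?P. of_int ((int (N - 1 - s p) - int (N - 1)) * int (?w c p)) * (?V s * mono c))" for p
    proof -
      have v: "vand_euler N x p - of_nat (N - 1) * vand N x =
          (\<Sum>s\<in>?P. of_int (int (N - 1 - s p) - int (N - 1)) * ?V s)"
        unfolding vand_def vand_euler_def sum_distrib_left sum_subtractf[symmetric]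
        by (intro sum.cong refl) (simp add: algebra_simps)
      show ?thesis
        unfolding v euler_def sum_product
        by (subst sum.swap) (simp add: mult_ac)
    qed
    have "(\<Sum>p<N. (vand_euler N x p - of_nat (N - 1) * vand N x) * euler p) =
      (\<Sum>p<N. \<Sum>c\<in>?F. \<Sum>s\<in>?P. of_int ((int (N - 1 - s p) - int (N - 1)) * int (?w c p)) * (?V s * mono c))"
      by (simp only: e)
    also have "\<dots> = (\<Sum>c\<in>?F. \<Sum>p<N. \<Sum>s\<in>?P. of_int ((int (N - 1 - s p) - int (N - 1)) * int (?w c p)) * (?V s * mono c))"
      by (rule sum.swap)
    also have "\<dots> = (\<Sum>c\<in>?F. \<Sum>s\<in>?P. \<Sum>p<N. of_int ((int (N - 1 - s p) - int (N - 1)) * int (?w c p)) * (?V s * mono c))"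
      by (intro sum.cong refl sum.swap)
    finally show ?thesis
      by (simp only: of_int_sum sum_distrib_right)
  qed
  also have "(\<Sum>c\<in>?F. \<Sum>s\<in>?P. of_int (int (\<Sum>p<N. ?w c p * (?w c p - 1))) * (?V s * mono c)) +
      2 * (\<Sum>c\<in>?F. \<Sum>s\<in>?P. of_int (\<Sum>p<N. (int (N - 1 - s p) - int (N - 1)) * int (?w c p)) * (?V s * mono c)) =
      (\<Sum>c\<in>?F. \<Sum>s\<in>?P. of_int (double_content N (\<lambda>p. ?w c p + (N - 1 - s p))) * (?V s * mono c))"
    unfolding sum_distrib_left sum.distrib[symmetric]
    by (intro sum.cong refl) (simp only: cont of_int_add of_int_mult of_int_numeral ring_distribs mult.assoc)
  also have "\<dots> = (\<Sum>c\<in>?F. \<Sum>s\<in>?P.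
      of_int (sign s * double_content N (\<lambda>p. ?w c p + (N - 1 - s p))) * (\<Prod>p<N. x p ^ (?w c p + (N - 1 - s p))))"
  proof (intro sum.cong refl)
    fix c s assume "c \<in> ?F"
    then have "mono c = (\<Prod>p<N. x p ^ ?w c p)"
      unfolding mono_def by (intro prod_colouring) (simp add: fixed_colourings_def)
    then show "of_int (double_content N (\<lambda>p. ?w c p + (N - 1 - s p))) * (?V s * mono c) =
        of_int (sign s * double_content N (\<lambda>p. ?w c p + (N - 1 - s p))) * (\<Prod>p<N. x p ^ (?w c p + (N - 1 - s p)))"
      by (simp add: power_add prod.distrib mult_ac)
  qed
  finally show ?thesis unfolding mono_def .
qed

section \<open>Coefficients of alternants in integer polynomials\<close>

type_synonym mpoly = "(nat \<Rightarrow>\<^sub>0 nat) \<Rightarrow>\<^sub>0 int"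

text \<open>Indeterminates are an injective family in an integral domain of characteristic 0, so the
  identity for alternants applies to them, and there it can be read coefficient by
  coefficient.\<close>

definition var :: "nat \<Rightarrow> mpoly" where
  "var p = Poly_Mapping.single (Poly_Mapping.single p 1) 1"

definition coef_at :: "nat \<Rightarrow> (nat \<Rightarrow> nat) \<Rightarrow> mpoly \<Rightarrow> int" where
  "coef_at N l f = Poly_Mapping.lookup f (\<Sum>p<N. Poly_Mapping.single p (l p))"

lemma coef_at_sum: "coef_at N l (sum f A) = (\<Sum>a\<in>A. coef_at N l (f a))"
  by (simp add: coef_at_def lookup_sum)

lemma single_one_inject:
  "Poly_Mapping.single a (1::'b::zero_neq_one) = Poly_Mapping.single b 1 \<Longrightarrow> a = b"
  by (metis lookup_single_eq lookup_single_not_eq one_neq_zero)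

lemma inj_var: "inj var"
  unfolding inj_def var_def by (blast dest: single_one_inject)

lemma prod_var: "(\<Prod>p<N. var p ^ a p) = Poly_Mapping.single (\<Sum>p<N. Poly_Mapping.single p (a p)) 1"
proof -
  have pow: "var p ^ k = Poly_Mapping.single (Poly_Mapping.single p k) 1" for p k
    by (induction k) (auto simp: var_def mult_single single_add[symmetric] simp flip: single_one)
  show ?thesis
    by (induction N) (auto simp: pow mult_single simp flip: single_one)
qed

lemma coef_at_monomial:
  "coef_at N l (of_int k * (\<Prod>p<N. var p ^ a p)) = (if \<forall>p<N. a p = l p then k else 0)"
proof -
  have lookup: "Poly_Mapping.lookup (\<Sum>p<N. Poly_Mapping.single p (b p)) q = (if q < N then b q else 0)"
    for b :: "nat \<Rightarrow> nat" and q
    by (simp add: lookup_sum lookup_single when_def)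
  have "(\<Sum>p<N. Poly_Mapping.single p (a p)) = (\<Sum>p<N. Poly_Mapping.single p (l p)) \<longleftrightarrow> (\<forall>p<N. a p = l p)"
    unfolding poly_mapping_eq_iff fun_eq_iff lookup by auto
  moreover have "of_int k * (\<Prod>p<N. var p ^ a p) = Poly_Mapping.single (\<Sum>p<N. Poly_Mapping.single p (a p)) k"
    unfolding prod_var single_of_int[symmetric] by (simp add: mult_single)
  ultimately show ?thesis
    by (simp add: coef_at_def lookup_single when_def)
qed

text \<open>The coefficient of x^l in the Vandermonde polynomial times the power sum of
  \<open>g\<close>. By Frobenius it is the irreducible character of \<lambda> at \<open>g\<close>
  when l is \<lambda> plus the decreasing staircase.\<close>

definition alt_coef :: "nat \<Rightarrow> nat \<Rightarrow> (nat \<Rightarrow> nat) \<Rightarrow> (nat \<Rightarrow> nat) \<Rightarrow> int" where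
  "alt_coef d N g l = (\<Sum>c\<in>fixed_colourings d N g. \<Sum>s | s permutes {..<N}.
     if \<forall>p<N. weight d c p + (N - 1 - s p) = l p then sign s else 0)"

lemma vand_mult_colourings:
  fixes x :: "nat \<Rightarrow> 'a::comm_ring_1"
  assumes "A \<subseteq> colourings d N"
  shows "vand N x * (\<Sum>c\<in>A. \<Prod>k\<in>{1..d}. x (c k)) =
    (\<Sum>c\<in>A. \<Sum>s | s permutes {..<N}. of_int (sign s) * (\<Prod>p<N. x p ^ (weight d c p + (N - 1 - s p))))"
proof -
  have "vand N x * (\<Sum>c\<in>A. \<Prod>k\<in>{1..d}. x (c k)) = vand N x * (\<Sum>c\<in>A. \<Prod>p<N. x p ^ weight d c p)"
    using assms by (intro arg_cong2[where f="(*)"] sum.cong refl prod_colouring) auto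
  then show ?thesis
    unfolding vand_def sum_product by (subst sum.swap) (simp add: power_add prod.distrib mult_ac)
qed

text \<open>The class sum of transpositions acts on an irreducible character by a scalar. A
  colouring is fixed by \<open>transpose i j \<circ> g\<close> exactly when
  \<open>c \<circ> transpose i j = c \<circ> inv g\<close>, so the polynomial identity is used at
  \<open>inv g\<close>, which fixes the same colourings as \<open>g\<close>.\<close>

lemma sum_transpositions_alt_coef:
  assumes g: "g permutes {1..d}"
  shows "(\<Sum>(i,j)\<in>{(i,j)\<in>{1..d}\<times>{1..d}. i \<noteq> j}. alt_coef d N (transpose i j \<circ> g) l) =
    double_content N l * alt_coef d N g l"
proof -
  let ?P = "{(i,j)\<in>{1..d}\<times>{1..d}. i \<noteq> j}"
  let ?A = "\<lambda>i j. {c\<in>colourings d N. c \<circ> transpose i j = c \<circ> inv g}"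
  have gi: "inv g permutes {1..d}" using g by (rule permutes_inv)
  have cancel: "c \<circ> g \<circ> inv g = c" "c \<circ> inv g \<circ> g = c" for c :: "nat \<Rightarrow> nat"
    using permutes_inv_o[OF g] by (simp_all add: comp_assoc)
  have "c \<circ> (t \<circ> g) = c \<longleftrightarrow> c \<circ> t = c \<circ> inv g" for c t :: "nat \<Rightarrow> nat"
    by (metis cancel comp_assoc)
  then have A: "fixed_colourings d N (transpose i j \<circ> g) = ?A i j" for i j
    by (simp only: fixed_colourings_def)
  have "c \<circ> inv g = c \<longleftrightarrow> c \<circ> g = c" for c :: "nat \<Rightarrow> nat"
    using cancel[of c] by auto
  then have F: "fixed_colourings d N (inv g) = fixed_colourings d N g"
    by (simp only: fixed_colourings_def)
  have "coef_at N l (vand N var * (\<Sum>(i,j)\<in>?P. \<Sum>c\<in>?A i j. \<Prod>k\<in>{1..d}. var (c k))) =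
      (\<Sum>(i,j)\<in>?P. alt_coef d N (transpose i j \<circ> g) l)"
    unfolding sum_distrib_left coef_at_sum case_prod_unfold
  proof (rule sum.cong[OF refl])
    fix a
    have "coef_at N l (vand N var * (\<Sum>c\<in>?A (fst a) (snd a). \<Prod>k\<in>{1..d}. var (c k))) =
        alt_coef d N (transpose (fst a) (snd a) \<circ> g) l"
      unfolding alt_coef_def A
      by (subst vand_mult_colourings) (auto simp: coef_at_sum coef_at_monomial)
    then show "(\<Sum>c\<in>?A (fst a) (snd a). coef_at N l (vand N var * (\<Prod>k\<in>{1..d}. var (c k)))) =
        alt_coef d N (transpose (fst a) (snd a) \<circ> g) l"
      by (simp only: sum_distrib_left coef_at_sum)
  qed
  moreover have "coef_at N l (vand N var * (\<Sum>(i,j)\<in>?P. \<Sum>c\<in>?A i j. \<Prod>k\<in>{1..d}. var (c k))) =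
      double_content N l * alt_coef d N g l"
  proof -
    have "double_content N (\<lambda>p. weight d c p + (N - 1 - s p)) = double_content N l"
      if "\<forall>p<N. weight d c p + (N - 1 - s p) = l p" for c s
      using that by (simp add: double_content_def)
    then show ?thesis
      unfolding vand_mult_transposed[OF inj_on_subset[OF inj_var subset_UNIV] gi] F
      unfolding coef_at_sum coef_at_monomial alt_coef_def sum_distrib_left
      by (intro sum.cong refl) auto
  qed
  ultimately show ?thesis by simp
qed

subsection \<open>Extracting the identity\<close>

text \<open>The value 0 at negative integers makes n * \<open>ifact n\<close> =
  \<open>ifact (n - 1)\<close> hold for every integer, also at n = 0.\<close>

definition ifact :: "int \<Rightarrow> rat" where
  "ifact n = (if n < 0 then 0 else 1 / fact (nat n))"

lemma ifact_0 [simp]: "ifact 0 = 1"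
  by (simp add: ifact_def)

lemma ifact_neg [simp]: "n < 0 \<Longrightarrow> ifact n = 0"
  by (simp add: ifact_def)

lemma ifact_of_nat: "ifact (int k) = 1 / fact k"
  by (simp add: ifact_def)

lemma of_int_mult_ifact: "of_int n * ifact n = ifact (n - 1)"
proof (cases "n > 0")
  case True
  then obtain k where k: "nat n = Suc k" by (metis gr0_implies_Suc zero_less_nat_eq)
  then have n: "n = int (Suc k)" by linarith
  have n1: "int (Suc k) - 1 = int k" by simp
  show ?thesis unfolding n n1 ifact_of_nat by (simp add: fact_Suc del: of_nat_Suc)
qed (auto simp: ifact_def)

lemma sum_mult_prod_ifact:
  assumes "finite S"
  shows "of_int (\<Sum>i\<in>S. n i) * (\<Prod>i\<in>S. ifact (n i)) = (\<Sum>p\<in>S. \<Prod>i\<in>S. ifact ((n(p := n p - 1)) i))"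
  unfolding of_int_sum sum_distrib_right
proof (rule sum.cong[OF refl])
  fix p assume p: "p \<in> S"
  have "(\<Prod>i\<in>S. ifact ((n(p := n p - 1)) i)) = ifact (n p - 1) * (\<Prod>i\<in>S-{p}. ifact (n i))"
    using assms p by (subst prod.remove[of S p]) (auto intro!: arg_cong2[where f="(*)"] prod.cong)
  then show "of_int (n p) * (\<Prod>i\<in>S. ifact (n i)) = (\<Prod>i\<in>S. ifact ((n(p := n p - 1)) i))"
    using assms p by (simp add: prod.remove[of S p] of_int_mult_ifact flip: mult.assoc)
qed

text \<open>The determinant of the reciprocal factorials of l_i - (N - 1 - j). Arguments are
  integers because the recursion lowers entries and can reach -1.\<close>

definition kern :: "nat \<Rightarrow> (nat \<Rightarrow> int) \<Rightarrow> rat" where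
  "kern N l = (\<Sum>s | s permutes {..<N}. of_int (sign s) * (\<Prod>i<N. ifact (l i - int (N - 1 - s i))))"

lemma kern_cong: "(\<And>i. i < N \<Longrightarrow> l i = l' i) \<Longrightarrow> kern N l = kern N l'"
  by (auto simp: kern_def)

lemma kern_permute:
  assumes t: "t permutes {..<N}"
  shows "kern N (l \<circ> t) = of_int (sign t) * kern N l"
proof -
  have pt: "permutation t" using t permutation_permutes by blast
  have "kern N (l \<circ> t) = (\<Sum>s | s permutes {..<N}.
      of_int (sign t) * (of_int (sign s) * (\<Prod>i<N. ifact (l i - int (N - 1 - s i)))))"
    unfolding kern_def
  proof (rule sum.reindex_bij_witness[where i = "\<lambda>s. s \<circ> t" and j = "\<lambda>s. s \<circ> inv t"])
    fix s assume s: "s \<in> {s. s permutes {..<N}}"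
    then have ps: "permutation s" using permutation_permutes by blast
    have "(\<Prod>i<N. ifact (l i - int (N - 1 - (s \<circ> inv t) i))) =
        (\<Prod>i<N. ifact (l (t i) - int (N - 1 - (s \<circ> inv t) (t i))))"
      by (rule prod.reindex_bij_betw[OF permutes_imp_bij[OF t], symmetric])
    also have "\<dots> = (\<Prod>i<N. ifact ((l \<circ> t) i - int (N - 1 - s i)))"
      using permutes_inverses[OF t] by simp
    finally show "of_int (sign t) * (of_int (sign (s \<circ> inv t)) *
        (\<Prod>i<N. ifact (l i - int (N - 1 - (s \<circ> inv t) i)))) =
        of_int (sign s) * (\<Prod>i<N. ifact ((l \<circ> t) i - int (N - 1 - s i)))"
      using pt ps by (simp add: sign_compose permutation_inverse sign_inverse flip: of_int_mult mult.assoc)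
  qed (use t permutes_inv[OF t] permutes_inv_o[OF t] in \<open>auto simp: comp_assoc intro: permutes_compose\<close>)
  then show ?thesis by (simp add: kern_def sum_distrib_left)
qed

lemma kern_not_inj:
  assumes "p < N" "q < N" "p \<noteq> q" "l p = l q"
  shows "kern N l = 0"
proof -
  have "l \<circ> transpose p q = l"
    using assms(4) by (auto simp: fun_eq_iff transpose_def)
  then have "kern N l = - kern N l"
    using kern_permute[of "transpose p q" N l] assms by (simp add: permutes_swap_id sign_swap_id)
  then show ?thesis by simp
qed

lemma kern_neg:
  assumes "p < N" "l p < 0"
  shows "kern N l = 0"
proof -
  have z: "(\<Prod>i<N. ifact (l i - int (N - 1 - s i))) = 0" for s
    using assms by (intro prod_zero bexI[of _ p]) auto
  show ?thesis unfolding kern_def z by simp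
qed

lemma sum_lessThan_card_le:
  fixes S :: "nat set"
  shows "finite S \<Longrightarrow> \<Sum>{..<card S} \<le> \<Sum>S"
proof (induction S rule: finite_linorder_max_induct)
  case (insert b A)
  have "card A \<le> b"
    using card_mono[of "{..<b}" A] insert.hyps by auto
  moreover have "b \<notin> A" using insert.hyps by auto
  ultimately show ?case
    using insert by (simp add: lessThan_Suc)
qed simp

text \<open>A nonzero value forces the \<open>l i\<close> to be distinct, and N distinct positive
  integers add up to at least N plus the staircase sum.\<close>

lemma kern_pos:
  assumes pos: "\<And>i. i < N \<Longrightarrow> l i \<ge> 1" and small: "(\<Sum>i<N. l i) < int N + (\<Sum>i<N. int i)"
  shows "kern N l = 0"
proof (rule ccontr)
  assume "kern N l \<noteq> 0"
  then have inj: "inj_on l {..<N}"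
    by (meson inj_onI kern_not_inj lessThan_iff)
  define f where "f = (\<lambda>i. nat (l i - 1))"
  have f: "int (f i) = l i - 1" if "i < N" for i
    using pos[OF that] by (simp add: f_def)
  have "inj_on f {..<N}"
  proof (rule inj_onI)
    fix i j assume ij: "i \<in> {..<N}" "j \<in> {..<N}" "f i = f j"
    then have "l i - 1 = l j - 1" using f[of i] f[of j] by simp
    with inj ij show "i = j" by (auto dest: inj_onD)
  qed
  then have "\<Sum>{..<N} \<le> (\<Sum>i<N. f i)"
    using sum_lessThan_card_le[of "f ` {..<N}"] by (simp add: card_image sum.reindex)
  then have "int (\<Sum>{..<N}) \<le> int (\<Sum>i<N. f i)" by (simp only: of_nat_le_iff)
  also have "\<dots> = (\<Sum>i<N. l i - 1)" by (simp add: f)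
  finally show False using small by (simp add: sum_subtractf)
qed

lemma sum_stair: "s permutes {..<N} \<Longrightarrow> (\<Sum>i<N. int (N - 1 - s i)) = (\<Sum>i<N. int i)"
proof -
  assume s: "s permutes {..<N}"
  have "bij_betw (\<lambda>p. N - 1 - p) {..<N} {..<N}"
    by (rule bij_betw_byWitness[where f' = "\<lambda>p. N - 1 - p"]) auto
  then have "bij_betw (\<lambda>p. N - 1 - s p) {..<N} {..<N}"
    using bij_betw_trans[OF permutes_imp_bij[OF s]] by (auto simp: comp_def)
  then show ?thesis
    by (rule sum.reindex_bij_betw)
qed

text \<open>In each term of the determinant the arguments of \<open>ifact\<close> add up to d,
  whatever the permutation, so the multinomial recursion applies term by term. For partitions this
  is the branching rule for dimensions, divided by (d - 1)!.\<close>

lemma kern_rec: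
  assumes "(\<Sum>i<N. l i) = int d + (\<Sum>i<N. int i)"
  shows "of_nat d * kern N l = (\<Sum>p<N. kern N (l(p := l p - 1)))"
proof -
  let ?n = "\<lambda>s i. l i - int (N - 1 - s i)"
  have "of_nat d * (\<Prod>i<N. ifact (?n s i)) = (\<Sum>p<N. \<Prod>i<N. ifact ((l(p := l p - 1)) i - int (N - 1 - s i)))"
    if "s permutes {..<N}" for s
  proof -
    have "(\<Sum>i<N. ?n s i) = int d"
      using assms sum_stair[OF that] by (simp add: sum_subtractf)
    then have "of_nat d * (\<Prod>i<N. ifact (?n s i)) = of_int (\<Sum>i<N. ?n s i) * (\<Prod>i<N. ifact (?n s i))"
      by (simp only: of_int_of_nat_eq)
    also have "\<dots> = (\<Sum>p<N. \<Prod>i<N. ifact (((?n s)(p := ?n s p - 1)) i))"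
      by (rule sum_mult_prod_ifact) simp
    also have "\<dots> = (\<Sum>p<N. \<Prod>i<N. ifact ((l(p := l p - 1)) i - int (N - 1 - s i)))"
      by (intro sum.cong prod.cong refl arg_cong[where f=ifact]) auto
    finally show ?thesis .
  qed
  then have "of_nat d * kern N l = (\<Sum>s | s permutes {..<N}. of_int (sign s) *
      (\<Sum>p<N. \<Prod>i<N. ifact ((l(p := l p - 1)) i - int (N - 1 - s i))))"
    unfolding kern_def sum_distrib_left by (intro sum.cong refl) (simp add: mult.left_commute flip: sum_distrib_left)
  also have "\<dots> = (\<Sum>p<N. kern N (l(p := l p - 1)))"
    unfolding kern_def sum_distrib_left by (rule sum.swap)
  finally show ?thesis .
qed

text \<open>The last row vanishes except for a 1 in the last column. Deleting both lowers the
  staircase by one, which is compensated in the remaining entries.\<close>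

lemma kern_Suc:
  assumes "l N = 0"
  shows "kern (Suc N) l = kern N (\<lambda>i. l i - 1)"
proof -
  have "(\<Prod>i<Suc N. ifact (l i - int (Suc N - 1 - s i))) = 0" if "s permutes {..<Suc N}" "\<not> s permutes {..<N}" for s
  proof -
    have "s N \<noteq> N"
    proof
      assume "s N = N"
      then have "s permutes {..<N}"
        using that(1) by (intro permutes_superset[OF that(1)]) auto
      with that(2) show False by simp
    qed
    moreover have "s N < Suc N"
      using permutes_in_image[OF that(1), of N] by simp
    ultimately have "l N - int (Suc N - 1 - s N) < 0"
      using assms by simp
    then show ?thesis by simp
  qed
  then have "kern (Suc N) l = (\<Sum>s | s permutes {..<N}. of_int (sign s) * (\<Prod>i<Suc N. ifact (l i - int (Suc N - 1 - s i))))"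
    unfolding kern_def
    by (intro sum.mono_neutral_right finite_permutations finite_lessThan) (auto intro: permutes_subset)
  also have "\<dots> = kern N (\<lambda>i. l i - 1)"
    unfolding kern_def
  proof (intro sum.cong refl arg_cong2[where f="(*)"])
    fix s assume s: "s \<in> {s. s permutes {..<N}}"
    then have "s N = N" by (auto simp: permutes_def)
    have "s i < N" if "i < N" for i
      using s that permutes_in_image[of s "{..<N}" i] by auto
    then have e: "l i - int (Suc N - 1 - s i) = l i - 1 - int (N - 1 - s i)" if "i < N" for i
      using \<open>\<And>i. i < N \<Longrightarrow> s i < N\<close>[OF that] by linarith
    have "(\<Prod>i<Suc N. ifact (l i - int (Suc N - 1 - s i))) = (\<Prod>i<N. ifact (l i - int (Suc N - 1 - s i)))"
      using assms \<open>s N = N\<close> by simp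
    also have "\<dots> = (\<Prod>i<N. ifact (l i - 1 - int (N - 1 - s i)))"
      by (intro prod.cong refl arg_cong[where f=ifact] e) simp
    finally show "(\<Prod>i<Suc N. ifact (l i - int (Suc N - 1 - s i))) = (\<Prod>i<N. ifact (l i - 1 - int (N - 1 - s i)))" .
  qed
  finally show ?thesis .
qed

text \<open>The matrix is unitriangular: every permutation other than the identity has some
  \<open>s i < i\<close>, which makes an argument of \<open>ifact\<close> negative.\<close>

lemma kern_stair: "kern N (\<lambda>i. int (N - 1 - i)) = 1"
proof -
  have "(\<Prod>i<N. ifact (int (N - 1 - i) - int (N - 1 - s i))) = 0" if s: "s permutes {..<N}" and ne: "s \<noteq> id" for s
  proof -
    obtain i where i: "i < N" "s i < i"
    proof (rule ccontr)
      assume "\<not> thesis"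
      with that have "\<forall>i\<in>{..<N}. i \<le> s i"
        by (meson lessThan_iff not_le)
      with permutes_natset_ge[OF s] ne show False by blast
    qed
    then show ?thesis
      by (intro prod_zero bexI[of _ i]) auto
  qed
  then have "kern N (\<lambda>i. int (N - 1 - i)) = (\<Sum>s\<in>{id}. of_int (sign s) * (\<Prod>i<N. ifact (int (N - 1 - i) - int (N - 1 - s i))))"
    unfolding kern_def
    by (intro sum.mono_neutral_right finite_permutations finite_lessThan) (auto simp: permutes_id)
  then show ?thesis by simp
qed

text \<open>Zeros from N on give each vector of length N a single representative, stable under
  permutations of the first N indices.\<close>

definition compositions :: "nat \<Rightarrow> nat \<Rightarrow> (nat \<Rightarrow> nat) set" where
  "compositions N m = {v. (\<forall>i\<ge>N. v i = 0) \<and> (\<Sum>i<N. v i) = m}"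

lemma finite_compositions [simp]: "finite (compositions N m)"
proof (rule finite_subset)
  show "compositions N m \<subseteq> {v. \<forall>i. (i \<in> {..<N} \<longrightarrow> v i \<in> {..m}) \<and> (i \<notin> {..<N} \<longrightarrow> v i = 0)}"
  proof
    fix v assume v: "v \<in> compositions N m"
    then have "v i \<le> m" if "i < N" for i
      using member_le_sum[of i "{..<N}" v] that by (simp add: compositions_def)
    with v show "v \<in> {v. \<forall>i. (i \<in> {..<N} \<longrightarrow> v i \<in> {..m}) \<and> (i \<notin> {..<N} \<longrightarrow> v i = 0)}"
      by (simp add: compositions_def)
  qed
qed (rule finite_set_of_finite_funs; simp)

lemma sum_composition_stair:
  assumes "v \<in> compositions N m"
  shows "(\<Sum>i<N. int (v i + (N - 1 - i))) = int m + (\<Sum>i<N. int i)"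
proof -
  have "(\<Sum>i<N. int (v i + (N - 1 - i))) = int (\<Sum>i<N. v i) + (\<Sum>i<N. int (N - 1 - id i))"
    by (simp only: of_nat_add sum.distrib of_nat_sum id_apply)
  also have "(\<Sum>i<N. v i) = m"
    using assms by (simp add: compositions_def)
  finally show ?thesis
    unfolding sum_stair[OF permutes_id] .
qed

lemma compositions_permute:
  assumes t: "t permutes {..<N}" and v: "v \<in> compositions N m"
  shows "v \<circ> t \<in> compositions N m"
  using v sum.reindex_bij_betw[OF permutes_imp_bij[OF t], of v]
  by (auto simp: compositions_def permutes_not_in[OF t])

text \<open>In the recursion for \<^term>\<open>kern\<close>, lowering the part \<^term>\<open>p\<close> is antisymmetric under swapping
  \<^term>\<open>p\<close> and \<^term>\<open>p + 1\<close>; only lowering the last part survives, and there the part has to be 1.\<close>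

lemma kern_pairing:
  fixes \<phi> :: "(nat \<Rightarrow> nat) \<Rightarrow> rat"
  assumes "d \<le> N" and "\<And>t v. t permutes {..<N} \<Longrightarrow> \<phi> (v \<circ> t) = \<phi> v"
  shows "fact d * (\<Sum>v\<in>compositions N d. kern N (\<lambda>i. int (v i + (N - 1 - i))) * \<phi> v) =
    \<phi> (\<lambda>i. if i < d then 1 else 0)"
  using assms
proof (induction d arbitrary: N \<phi>)
  case 0
  have "compositions N 0 = {\<lambda>_. 0}"
    by (auto simp: compositions_def fun_eq_iff) (metis lessThan_iff linorder_not_less)
  then show ?case using kern_stair[of N] by simp
next
  case (Suc d)
  note sym = Suc.prems(2)
  obtain n where N: "N = Suc n" using Suc.prems(1) by (cases N) auto
  let ?\<delta> = "\<lambda>i. N - 1 - i"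
  let ?l = "\<lambda>v p i. if i = p then int (v i + ?\<delta> i) - 1 else int (v i + ?\<delta> i)"
  define lowered where "lowered = (\<lambda>p. \<Sum>v\<in>compositions N (Suc d). kern N (?l v p) * \<phi> v)"
  have rec: "of_nat (Suc d) * kern N (\<lambda>i. int (v i + ?\<delta> i)) = (\<Sum>p<N. kern N (?l v p))"
    if "v \<in> compositions N (Suc d)" for v
  proof -
    have u: "(\<lambda>i. int (v i + ?\<delta> i))(p := int (v p + ?\<delta> p) - 1) = ?l v p" for p
      by (auto simp: fun_eq_iff)
    show ?thesis
      using kern_rec[OF sum_composition_stair[OF that]] unfolding u .
  qed
  have "of_nat (Suc d) * (\<Sum>v\<in>compositions N (Suc d). kern N (\<lambda>i. int (v i + ?\<delta> i)) * \<phi> v) =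
      (\<Sum>v\<in>compositions N (Suc d). \<Sum>p<N. kern N (?l v p) * \<phi> v)"
    unfolding sum_distrib_left
  proof (rule sum.cong[OF refl])
    fix v assume "v \<in> compositions N (Suc d)"
    from rec[OF this] show "of_nat (Suc d) * (kern N (\<lambda>i. int (v i + ?\<delta> i)) * \<phi> v) = (\<Sum>p<N. kern N (?l v p) * \<phi> v)"
      by (simp only: mult.assoc[symmetric] sum_distrib_right)
  qed
  also have "\<dots> = (\<Sum>p<N. lowered p)"
    unfolding lowered_def by (rule sum.swap)
  also have "\<dots> = lowered n"
  proof -
    have "lowered p = 0" if p: "p < n" for p
    proof -
      let ?t = "transpose p (Suc p)"
      have t: "?t permutes {..<N}" using p N by (intro permutes_swap_id) auto
      have "lowered p = (\<Sum>v\<in>compositions N (Suc d). - (kern N (?l v p) * \<phi> v))"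
        unfolding lowered_def
      proof (rule sum.reindex_bij_witness[where i = "\<lambda>v. v \<circ> ?t" and j = "\<lambda>v. v \<circ> ?t"])
        fix v assume v: "v \<in> compositions N (Suc d)"
        have "?l (v \<circ> ?t) p = ?l v p \<circ> ?t"
          using p N by (auto simp: fun_eq_iff transpose_def)
        then have "kern N (?l (v \<circ> ?t) p) = - kern N (?l v p)"
          using kern_permute[OF t, of "?l v p"] by (simp add: sign_swap_id)
        then show "- (kern N (?l (v \<circ> ?t) p) * \<phi> (v \<circ> ?t)) = kern N (?l v p) * \<phi> v"
          by (simp add: sym[OF t])
      qed (auto simp: comp_assoc intro: compositions_permute[OF t])
      then have "lowered p = - lowered p" by (simp add: lowered_def sum_negf)
      then show ?thesis by simp
    qed
    then show ?thesis by (simp add: N)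
  qed
  also have "lowered n = (\<Sum>v\<in>{v\<in>compositions N (Suc d). v n = 1}. kern N (?l v n) * \<phi> v)"
    unfolding lowered_def
  proof (intro sum.mono_neutral_right ballI)
    fix v assume v: "v \<in> compositions N (Suc d) - {v \<in> compositions N (Suc d). v n = 1}"
    \<comment> \<open>A last part 0 is lowered to a negative entry. If it is at least 2, all N
      entries stay positive after lowering, while their sum, d plus the staircase sum, is too small
      because d < N.\<close>
    have "kern N (?l v n) = 0"
    proof (cases "v n = 0")
      case True
      then show ?thesis by (intro kern_neg[of n]) (auto simp: N)
    next
      case False
      with v have "v n \<ge> 2" by auto
      have "(\<Sum>i<N. ?l v n i) = (\<Sum>i<N. int (v i + ?\<delta> i)) - 1"
        by (simp add: N)
      also have "\<dots> = int d + (\<Sum>i<N. int i)"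
        using v sum_composition_stair[of v N "Suc d"] by simp
      finally show ?thesis
        using \<open>v n \<ge> 2\<close> Suc.prems(1) by (intro kern_pos) (auto simp: N)
    qed
    then show "kern N (?l v n) * \<phi> v = 0" by simp
  qed auto
  also have "\<dots> = (\<Sum>v\<in>compositions n d. kern n (\<lambda>i. int (v i + (n - 1 - i))) * \<phi> (v(n := 1)))"
  proof (rule sum.reindex_bij_witness[where i = "\<lambda>v. v(n := 1)" and j = "\<lambda>v. v(n := 0)"])
    fix v assume v: "v \<in> {v\<in>compositions N (Suc d). v n = 1}"
    then show "v(n := 0, n := 1) = v" by (auto simp: fun_eq_iff)
    show "v(n := 0) \<in> compositions n d"
      using v by (auto simp: compositions_def N)
    have "kern N (?l v n) = kern n (\<lambda>i. ?l v n i - 1)"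
      unfolding N by (rule kern_Suc) (use v N in auto)
    also have "\<dots> = kern n (\<lambda>i. int ((v(n := 0)) i + (n - 1 - i)))"
      by (rule kern_cong) (auto simp: N)
    finally show "kern n (\<lambda>i. int ((v(n := 0)) i + (n - 1 - i))) * \<phi> (v(n := 0, n := 1)) = kern N (?l v n) * \<phi> v"
      using \<open>v(n := 0, n := 1) = v\<close> by simp
  next
    fix v assume v: "v \<in> compositions n d"
    then show "v(n := 1, n := 0) = v" by (auto simp: compositions_def fun_eq_iff)
    show "v(n := 1) \<in> {v\<in>compositions N (Suc d). v n = 1}"
      using v by (auto simp: compositions_def N)
  qed
  finally have step: "of_nat (Suc d) * (\<Sum>v\<in>compositions N (Suc d). kern N (\<lambda>i. int (v i + ?\<delta> i)) * \<phi> v) =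
    (\<Sum>v\<in>compositions n d. kern n (\<lambda>i. int (v i + (n - 1 - i))) * \<phi> (v(n := 1)))" .
  have "\<phi> ((v \<circ> t)(n := 1)) = \<phi> (v(n := 1))" if t: "t permutes {..<n}" for t v
  proof -
    have tn: "t n = n" using permutes_not_in[OF t] by simp
    have "t i = n \<longleftrightarrow> i = n" for i
      using permutes_inj[OF t] tn by (metis injD)
    then have "(v \<circ> t)(n := 1) = v(n := 1) \<circ> t"
      by (auto simp: fun_eq_iff)
    moreover have "t permutes {..<N}" using t by (rule permutes_subset) (auto simp: N)
    ultimately show ?thesis by (metis sym)
  qed
  moreover have "d \<le> n" using Suc.prems(1) by (simp add: N)
  ultimately have "fact d * (\<Sum>v\<in>compositions n d. kern n (\<lambda>i. int (v i + (n - 1 - i))) * \<phi> (v(n := 1))) =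
      \<phi> ((\<lambda>i. if i < d then 1 else 0)(n := 1))"
    by (intro Suc.IH[where \<phi> = "\<lambda>v. \<phi> (v(n := 1))"])
  \<comment> \<open>The new part 1 sits at position n; the symmetry of \<open>\<phi>\<close> moves
    it to position d.\<close>
  also have "\<dots> = \<phi> (\<lambda>i. if i < Suc d then 1 else 0)"
  proof -
    have "(\<lambda>i. if i < d then 1 else 0::nat)(n := 1) = (\<lambda>i. if i < Suc d then 1 else 0) \<circ> transpose d n"
      using Suc.prems(1) by (auto simp: fun_eq_iff transpose_def N)
    moreover have "transpose d n permutes {..<N}"
      using Suc.prems(1) by (intro permutes_swap_id) (auto simp: N)
    ultimately show ?thesis by (metis sym)
  qed
  finally show ?case
    unfolding step[symmetric] fact_Suc by (simp only: mult_ac)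
qed

subsection \<open>The character formula\<close>

definition recolour :: "nat \<Rightarrow> (nat \<Rightarrow> nat) \<Rightarrow> (nat \<Rightarrow> nat) \<Rightarrow> nat \<Rightarrow> nat" where
  "recolour d s c = restrict (s \<circ> c) {1..d}"

lemma recolour_fixed:
  assumes s: "s permutes {..<N}" and g: "g permutes {1..d}" and c: "c \<in> fixed_colourings d N g"
  shows "recolour d s c \<in> fixed_colourings d N g"
proof -
  have c': "c \<in> colourings d N" "c \<circ> g = c"
    using c by (auto simp: fixed_colourings_def)
  have "recolour d s c \<in> colourings d N"
    unfolding colourings_def
  proof (rule PiE_I)
    fix i assume "i \<in> {1..d}"
    then show "recolour d s c i \<in> {..<N}"
      using colouring_range[OF c'(1)] permutes_in_image[OF s] by (simp add: recolour_def)
  qed (auto simp: recolour_def restrict_def)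
  moreover have "recolour d s c \<circ> g = recolour d s c"
  proof
    fix i
    show "(recolour d s c \<circ> g) i = recolour d s c i"
      using permutes_in_image[OF g, of i] fun_cong[OF c'(2), of i]
      unfolding recolour_def restrict_def by simp
  qed
  ultimately show ?thesis by (simp add: fixed_colourings_def)
qed

lemma weight_recolour:
  assumes s: "s permutes {..<N}"
  shows "weight d (recolour d s c) p = weight d c (inv s p)"
proof -
  have "s (c i) = p \<longleftrightarrow> c i = inv s p" for i
    using permutes_inverses[OF s] by metis
  then have "{i\<in>{1..d}. recolour d s c i = p} = {i\<in>{1..d}. c i = inv s p}"
    by (auto simp: recolour_def)
  then show ?thesis by (simp add: weight_def)
qed

lemma recolour_recolour:
  assumes "s \<circ> t = id" "c \<in> colourings d N"
  shows "recolour d s (recolour d t c) = c"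
proof
  fix i
  show "recolour d s (recolour d t c) i = c i"
    using fun_cong[OF assms(1), of "c i"] assms(2)
    by (auto simp: recolour_def colourings_def PiE_def extensional_def)
qed

lemma weight_composition:
  assumes c: "c \<in> colourings d N"
  shows "weight d c \<in> compositions N d"
proof -
  have "weight d c p = 0" if "p \<ge> N" for p
    using colouring_range[OF c] that by (fastforce simp: weight_def)
  then show ?thesis
    using sum_weight[OF c] by (simp add: compositions_def)
qed

lemma sum_weight_recolour:
  assumes s: "s permutes {..<N}" and g: "g permutes {1..d}"
  shows "(\<Sum>c\<in>fixed_colourings d N g. f (weight d c \<circ> s)) = (\<Sum>c\<in>fixed_colourings d N g. f (weight d c))"
proof -
  have si: "inv s permutes {..<N}" using s by (rule permutes_inv)
  have inv: "inv (inv s) = s" using s by (rule permutes_inv_inv)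
  show ?thesis
  proof (rule sum.reindex_bij_witness[where i = "recolour d s" and j = "recolour d (inv s)"])
    fix c assume c: "c \<in> fixed_colourings d N g"
    then have c': "c \<in> colourings d N" by (simp add: fixed_colourings_def)
    show "recolour d s (recolour d (inv s) c) = c"
      using permutes_inv_o(1)[OF s] c' by (rule recolour_recolour)
    show "recolour d (inv s) (recolour d s c) = c"
      using permutes_inv_o(2)[OF s] c' by (rule recolour_recolour)
    show "recolour d s c \<in> fixed_colourings d N g" "recolour d (inv s) c \<in> fixed_colourings d N g"
      using recolour_fixed[OF s g c] recolour_fixed[OF si g c] by auto
    have "weight d (recolour d (inv s) c) = weight d c \<circ> s"
      by (rule ext) (simp add: weight_recolour[OF si] inv)
    then show "f (weight d (recolour d (inv s) c)) = f (weight d c \<circ> s)" by simp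
  qed
qed

text \<open>Permuting the colours by \<open>s\<close> reduces the term of \<open>s\<close> to that
  of the identity, and the sign produced by the antisymmetry of \<open>kern\<close> cancels the sign
  of \<open>s\<close>. All N! permutations therefore contribute equally.\<close>

lemma sum_kern_alt_coef:
  assumes g: "g permutes {1..d}"
  shows "(\<Sum>l\<in>compositions N (d + \<Sum>{..<N}). kern N (\<lambda>p. int (l p)) * of_int (alt_coef d N g l)) =
    fact N * (\<Sum>c\<in>fixed_colourings d N g. kern N (\<lambda>p. int (weight d c p + (N - 1 - p))))"
proof -
  let ?F = "fixed_colourings d N g" and ?P = "{s. s permutes {..<N}}" and ?C = "compositions N (d + \<Sum>{..<N})"
  let ?l = "\<lambda>c s p. weight d c p + (N - 1 - s p)"
  let ?ok = "\<lambda>c s l. \<forall>p<N. weight d c p + (N - 1 - s p) = l p"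
  have inner: "(\<Sum>l\<in>?C. kern N (\<lambda>p. int (l p)) * of_int (if ?ok c s l then sign s else 0)) =
      of_int (sign s) * kern N (\<lambda>p. int (?l c s p))"
    if c: "c \<in> ?F" and s: "s \<in> ?P" for c s
  proof -
    define l0 where "l0 = (\<lambda>p. if p < N then ?l c s p else 0)"
    have "(\<Sum>p<N. l0 p) = (\<Sum>p<N. weight d c p) + (\<Sum>p<N. N - 1 - s p)"
      by (simp add: l0_def sum.distrib)
    also have "(\<Sum>p<N. weight d c p) = d"
      using c by (intro sum_weight) (simp add: fixed_colourings_def)
    also have "(\<Sum>p<N. N - 1 - s p) = \<Sum>{..<N}"
    proof -
      have "int (\<Sum>p<N. N - 1 - s p) = int (\<Sum>{..<N})"
        using sum_stair[of s N] s by (simp only: of_nat_sum mem_Collect_eq)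
      then show ?thesis by (simp only: of_nat_eq_iff)
    qed
    finally have l0: "l0 \<in> ?C" by (simp add: compositions_def l0_def)
    have "?ok c s l \<longleftrightarrow> l = l0" if "l \<in> ?C" for l
      using that by (auto simp: l0_def compositions_def fun_eq_iff)
    then have "(\<Sum>l\<in>?C. kern N (\<lambda>p. int (l p)) * of_int (if ?ok c s l then sign s else 0)) =
        (\<Sum>l\<in>?C. if l = l0 then of_int (sign s) * kern N (\<lambda>p. int (l0 p)) else 0)"
      by (intro sum.cong refl) auto
    also have "\<dots> = of_int (sign s) * kern N (\<lambda>p. int (l0 p))"
      using l0 by (simp add: sum.delta)
    also have "kern N (\<lambda>p. int (l0 p)) = kern N (\<lambda>p. int (?l c s p))"
      by (rule kern_cong) (simp add: l0_def)
    finally show ?thesis by simp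
  qed
  have outer: "(\<Sum>c\<in>?F. of_int (sign s) * kern N (\<lambda>p. int (?l c s p))) =
      (\<Sum>c\<in>?F. kern N (\<lambda>p. int (weight d c p + (N - 1 - p))))" if "s \<in> ?P" for s
  proof -
    have s: "s permutes {..<N}" and si: "inv s permutes {..<N}"
      using that permutes_inv by auto
    have "of_int (sign s) * kern N (\<lambda>p. int (?l c s p)) =
        kern N (\<lambda>p. int ((weight d c \<circ> inv s) p + (N - 1 - p)))" for c
    proof -
      have "(\<lambda>p. int (?l c s p)) = (\<lambda>p. int ((weight d c \<circ> inv s) p + (N - 1 - p))) \<circ> s"
        using permutes_inverses[OF s] by (auto simp: fun_eq_iff)
      then have "kern N (\<lambda>p. int (?l c s p)) =
          of_int (sign s) * kern N (\<lambda>p. int ((weight d c \<circ> inv s) p + (N - 1 - p)))"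
        by (simp only: kern_permute[OF s])
      then show ?thesis by (simp only: mult.assoc[symmetric] of_int_mult[symmetric] sign_idempotent of_int_1 mult_1_left)
    qed
    then show ?thesis
      using sum_weight_recolour[OF si g, of "\<lambda>w. kern N (\<lambda>p. int (w p + (N - 1 - p)))"] by simp
  qed
  have "(\<Sum>l\<in>?C. kern N (\<lambda>p. int (l p)) * of_int (alt_coef d N g l)) =
      (\<Sum>l\<in>?C. \<Sum>c\<in>?F. \<Sum>s\<in>?P. kern N (\<lambda>p. int (l p)) * of_int (if ?ok c s l then sign s else 0))"
    unfolding alt_coef_def of_int_sum sum_distrib_left ..
  also have "\<dots> = (\<Sum>c\<in>?F. \<Sum>l\<in>?C. \<Sum>s\<in>?P. kern N (\<lambda>p. int (l p)) * of_int (if ?ok c s l then sign s else 0))"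
    by (rule sum.swap)
  also have "\<dots> = (\<Sum>c\<in>?F. \<Sum>s\<in>?P. \<Sum>l\<in>?C. kern N (\<lambda>p. int (l p)) * of_int (if ?ok c s l then sign s else 0))"
    by (intro sum.cong refl sum.swap)
  also have "\<dots> = (\<Sum>c\<in>?F. \<Sum>s\<in>?P. of_int (sign s) * kern N (\<lambda>p. int (?l c s p)))"
    by (rule sum.cong[OF refl], rule sum.cong[OF refl]) (rule inner)
  also have "\<dots> = (\<Sum>s\<in>?P. \<Sum>c\<in>?F. of_int (sign s) * kern N (\<lambda>p. int (?l c s p)))"
    by (rule sum.swap)
  also have "\<dots> = (\<Sum>s\<in>?P. \<Sum>c\<in>?F. kern N (\<lambda>p. int (weight d c p + (N - 1 - p))))"
    by (rule sum.cong[OF refl]) (rule outer)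
  also have "\<dots> = fact N * (\<Sum>c\<in>?F. kern N (\<lambda>p. int (weight d c p + (N - 1 - p))))"
    using card_permutations[of "{..<N}" N] by simp
  finally show ?thesis .
qed

text \<open>With this weight a colouring is a bijection onto the first d colours, and an injective
  colouring can be fixed by the identity only.\<close>

lemma card_injective_fixed_colourings:
  assumes g: "g permutes {1..d}" and "d \<le> N"
  shows "card {c\<in>fixed_colourings d N g. weight d c = (\<lambda>i. if i < d then 1 else 0)} = (if g = id then fact d else 0)"
proof -
  let ?S = "{c\<in>fixed_colourings d N g. weight d c = (\<lambda>i. if i < d then 1 else 0)}"
  have inj: "inj_on c {1..d}" if w: "weight d c = (\<lambda>i. if i < d then 1 else 0)" for c
  proof (rule inj_onI)
    fix i j assume ij: "i \<in> {1..d}" "j \<in> {1..d}" "c i = c j"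
    have "card {k\<in>{1..d}. c k = c i} \<le> 1"
      using fun_cong[OF w, of "c i"] by (simp add: weight_def)
    then show "i = j"
      using ij card_le_Suc0_iff_eq[of "{k\<in>{1..d}. c k = c i}"] by simp
  qed
  show ?thesis
  proof (cases "g = id")
    case True
    have "?S = {c \<in> {1..d} \<rightarrow>\<^sub>E {..<d}. inj_on c {1..d}}"
    proof (intro Set.set_eqI iffI)
      fix c assume c: "c \<in> ?S"
      have "c i < d" if "i \<in> {1..d}" for i
      proof (rule ccontr)
        assume "\<not> c i < d"
        with c have "weight d c (c i) = 0" by simp
        then have "{k\<in>{1..d}. c k = c i} = {}" by (simp add: weight_def)
        with that show False by blast
      qed
      with c inj show "c \<in> {c \<in> {1..d} \<rightarrow>\<^sub>E {..<d}. inj_on c {1..d}}"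
        by (auto simp: fixed_colourings_def colourings_def PiE_iff)
    next
      fix c assume c: "c \<in> {c \<in> {1..d} \<rightarrow>\<^sub>E {..<d}. inj_on c {1..d}}"
      then have im: "c ` {1..d} = {..<d}"
        by (intro card_subset_eq) (auto simp: card_image)
      have "weight d c p = (if p < d then 1 else 0)" for p
      proof (cases "p < d")
        case True
        then have "p \<in> c ` {1..d}" unfolding im by simp
        then obtain i where i: "i \<in> {1..d}" "c i = p" by (elim imageE) simp
        have "inj_on c {1..d}" using c by simp
        then have "c k = p \<longleftrightarrow> k = i" if "k \<in> {1..d}" for k
          using inj_on_eq_iff[of c "{1..d}" k i] that i by simp
        then have "{k\<in>{1..d}. c k = p} = {i}" using i(1) by blast
        then show ?thesis using True by (simp add: weight_def)
      next
        case False
        then have "p \<notin> c ` {1..d}" unfolding im by simp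
        then have "{k\<in>{1..d}. c k = p} = {}" by blast
        then show ?thesis using False by (simp add: weight_def)
      qed
      then show "c \<in> ?S"
        using c \<open>d \<le> N\<close> True by (fastforce simp: fixed_colourings_def colourings_def PiE_iff)
    qed
    moreover have "card {c \<in> {1..d} \<rightarrow>\<^sub>E {..<d}. inj_on c {1..d}} = fact d"
      using card_inj_on_subset_funcset[of "{1..d}" "{..<d}" "{1..d}"] by (simp add: fact_prod_rev)
    ultimately show ?thesis using True by simp
  next
    case False
    have "?S = {}"
    proof (rule equals0I)
      fix c assume c: "c \<in> ?S"
      have "g i = i" for i
      proof (cases "i \<in> {1..d}")
        case True
        have "c (g i) = c i"
          using c by (auto simp: fixed_colourings_def dest: fun_cong[of _ _ i])
        then show ?thesis
          using inj[of c] c True permutes_in_image[OF g, of i] by (auto dest: inj_onD)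
      next
        case False
        then show ?thesis using g by (simp add: permutes_def)
      qed
      with False show False by (auto simp: fun_eq_iff)
    qed
    then show ?thesis using False by simp
  qed
qed

text \<open>Grouping by weight gives a symmetric function of the weight, and
  \<open>kern_pairing\<close> evaluates its pairing at the weight (1,...,1,0,...,0). With
  \<open>sum_kern_alt_coef\<close> this is column orthogonality against the identity: the sum of dim
  \<lambda> times \<chi>(g) over all \<lambda> is d! at the identity and 0 elsewhere.\<close>

lemma sum_kern_fixed_colourings:
  assumes g: "g permutes {1..d}" and d: "d \<le> N"
  shows "(\<Sum>c\<in>fixed_colourings d N g. kern N (\<lambda>p. int (weight d c p + (N - 1 - p)))) = (if g = id then 1 else 0)"
proof -
  let ?F = "fixed_colourings d N g"
  define \<phi> where "\<phi> = (\<lambda>v. of_nat (card {c\<in>?F. weight d c = v}) :: rat)"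
  have "(\<Sum>c\<in>?F. kern N (\<lambda>p. int (weight d c p + (N - 1 - p)))) =
      (\<Sum>v\<in>compositions N d. \<Sum>c\<in>{c\<in>?F. weight d c = v}. kern N (\<lambda>p. int (weight d c p + (N - 1 - p))))"
    by (rule sum.group[symmetric]) (auto simp: fixed_colourings_def intro: weight_composition)
  also have "\<dots> = (\<Sum>v\<in>compositions N d. kern N (\<lambda>p. int (v p + (N - 1 - p))) * \<phi> v)"
    by (intro sum.cong refl) (simp add: \<phi>_def)
  finally have eq: "(\<Sum>c\<in>?F. kern N (\<lambda>p. int (weight d c p + (N - 1 - p)))) = \<dots>" .
  have sym: "\<phi> (v \<circ> t) = \<phi> v" if t: "t permutes {..<N}" for t v
  proof -
    have ind: "\<phi> u = (\<Sum>c\<in>?F. if weight d c = u then 1 else 0)" for u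
      by (simp add: \<phi>_def sum.If_cases Int_def)
    have "weight d c \<circ> t = v \<circ> t \<longleftrightarrow> weight d c = v" for c
    proof (intro iffI ext)
      fix i assume "weight d c \<circ> t = v \<circ> t"
      from fun_cong[OF this, of "inv t i"] show "weight d c i = v i"
        by (simp add: permutes_inverses[OF t])
    qed simp
    then have "\<phi> v = (\<Sum>c\<in>?F. if weight d c \<circ> t = v \<circ> t then 1 else 0 :: rat)"
      by (simp add: ind)
    then show ?thesis
      using sum_weight_recolour[OF t g, of "\<lambda>w. if w = v \<circ> t then 1 else 0 :: rat"] by (simp add: ind)
  qed
  have "fact d * (\<Sum>v\<in>compositions N d. kern N (\<lambda>p. int (v p + (N - 1 - p))) * \<phi> v) =
      \<phi> (\<lambda>i. if i < d then 1 else 0)"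
    by (rule kern_pairing[OF d sym])
  also have "\<dots> = (if g = id then fact d else 0)"
    using card_injective_fixed_colourings[OF g d] by (simp add: \<phi>_def)
  finally show ?thesis
    unfolding eq by (auto split: if_splits)
qed

section \<open>Multinomial counts and the dimension formula\<close>

lemma colourings_Suc:
  "colourings (Suc d) N = (\<lambda>(p,c). c(Suc d := p)) ` ({..<N} \<times> colourings d N)"
proof -
  have "{1..Suc d} = insert (Suc d) {1..d}" by auto
  then show ?thesis
    unfolding colourings_def by (simp only: PiE_insert_eq)
qed

text \<open>A multinomial coefficient, by induction on the colour of the last position. Integer
  \<open>n\<close> allows exponents minus a staircase to be inserted directly: a negative entry
  makes both sides 0.\<close>

lemma card_colourings_of_weight:
  assumes "(\<Sum>p<N. n p) = int d"
  shows "of_nat (card {c\<in>colourings d N. \<forall>p<N. int (weight d c p) = n p}) = fact d * (\<Prod>p<N. ifact (n p))"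
  using assms
proof (induction d arbitrary: n)
  case 0
  have c: "colourings 0 N = {\<lambda>_. undefined}" by (simp add: colourings_def)
  show ?case
  proof (cases "\<forall>p<N. n p = 0")
    case True
    then show ?thesis by (simp add: c weight_def)
  next
    case False
    have "\<exists>p<N. n p < 0"
    proof (rule ccontr)
      assume "\<not> (\<exists>p<N. n p < 0)"
      then have "\<forall>p\<in>{..<N}. 0 \<le> n p" by (metis lessThan_iff not_less)
      then have "\<forall>p\<in>{..<N}. n p = 0"
        using sum_nonneg_eq_0_iff[of "{..<N}" n] 0 by simp
      with False show False by auto
    qed
    then obtain p where "p < N" "n p < 0" by blast
    then have "(\<Prod>p<N. ifact (n p)) = 0" by (intro prod_zero bexI[of _ p]) auto
    moreover have "{c\<in>colourings 0 N. \<forall>p<N. int (weight 0 c p) = n p} = {}"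
      using False by (auto simp: weight_def)
    ultimately show ?thesis by (simp only: card.empty of_nat_0 mult_zero_right)
  qed
next
  case (Suc d)
  let ?S = "\<lambda>d n. {c\<in>colourings d N. \<forall>p<N. int (weight d c p) = n p}"
  let ?n = "\<lambda>q. n(q := n q - 1)"
  let ?f = "\<lambda>(q,c). c(Suc d := q)"
  have w: "weight (Suc d) (c(Suc d := q)) p = weight d c p + (if p = q then 1 else 0)" for c q p
  proof -
    have "{i\<in>{1..Suc d}. (c(Suc d := q)) i = p} =
        {i\<in>{1..d}. c i = p} \<union> (if p = q then {Suc d} else {})"
      by (auto simp: le_Suc_eq)
    then show ?thesis by (simp add: weight_def card_insert_if)
  qed
  have "?S (Suc d) n = ?f ` (SIGMA q:{..<N}. ?S d (?n q))"
  proof -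
    have *: "(\<forall>p<N. int (weight (Suc d) (c(Suc d := q)) p) = n p) \<longleftrightarrow> (\<forall>p<N. int (weight d c p) = ?n q p)"
      if "q < N" for c q
      using that by (intro all_cong) (auto simp: w)
    show ?thesis
    proof (intro Set.set_eqI iffI)
      fix c' assume c': "c' \<in> ?S (Suc d) n"
      have "c' \<in> colourings (Suc d) N" by (rule conjunct1[OF CollectD[OF c']])
      then obtain a where a: "a \<in> {..<N} \<times> colourings d N" "c' = ?f a"
        unfolding colourings_Suc by (rule imageE)
      obtain q c where "a = (q,c)" by (cases a)
      with a have q: "q < N" "c \<in> colourings d N" "c' = c(Suc d := q)" by simp_all
      moreover have "c \<in> ?S d (?n q)"
        using conjunct2[OF CollectD[OF c']] q(2) unfolding q(3) *[OF q(1)] by simp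
      ultimately show "c' \<in> ?f ` (SIGMA q:{..<N}. ?S d (?n q))"
        by (intro image_eqI[of _ _ "(q,c)"]) simp_all
    next
      fix c' assume "c' \<in> ?f ` (SIGMA q:{..<N}. ?S d (?n q))"
      then obtain a where a: "a \<in> (SIGMA q:{..<N}. ?S d (?n q))" "c' = ?f a"
        by (rule imageE)
      obtain q c where qc: "a = (q,c)" by (cases a)
      have q: "q < N" "c \<in> ?S d (?n q)" "c' = c(Suc d := q)"
        using a unfolding qc by simp_all
      have "c' \<in> colourings (Suc d) N"
        unfolding colourings_Suc q(3) using q(1,2) by (intro image_eqI[of _ _ "(q,c)"]) simp_all
      then show "c' \<in> ?S (Suc d) n"
        using conjunct2[OF CollectD[OF q(2)]] unfolding q(3) *[OF q(1), symmetric] by simp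
    qed
  qed
  moreover have "inj_on ?f (SIGMA q:{..<N}. ?S d (?n q))"
  proof (rule inj_onI)
    fix a b assume ab: "a \<in> (SIGMA q:{..<N}. ?S d (?n q))" "b \<in> (SIGMA q:{..<N}. ?S d (?n q))" "?f a = ?f b"
    obtain q c where a: "a = (q,c)" by (cases a)
    obtain q' c' where b: "b = (q',c')" by (cases b)
    have e: "(c(Suc d := q)) i = (c'(Suc d := q')) i" for i
      using ab(3) by (simp add: a b)
    have "c (Suc d) = undefined" "c' (Suc d) = undefined"
      using ab(1,2) by (auto simp: a b colourings_def PiE_def extensional_def)
    then have "c i = c' i" for i using e[of i] by (cases "i = Suc d") auto
    then show "a = b" using e[of "Suc d"] by (auto simp: a b)
  qed
  ultimately have "card (?S (Suc d) n) = (\<Sum>q<N. card (?S d (?n q)))"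
    by (simp add: card_image)
  then have "of_nat (card (?S (Suc d) n)) = (\<Sum>q<N. fact d * (\<Prod>p<N. ifact (?n q p)) :: rat)"
  proof -
    have "of_nat (card (?S d (?n q))) = (fact d * (\<Prod>p<N. ifact (?n q p)) :: rat)" if "q \<in> {..<N}" for q
    proof (rule Suc.IH)
      show "(\<Sum>p<N. ?n q p) = int d"
        using Suc.prems that by (simp add: sum.remove[of _ q])
    qed
    with \<open>card (?S (Suc d) n) = (\<Sum>q<N. card (?S d (?n q)))\<close> show ?thesis
      by (simp only: of_nat_sum cong: sum.cong)
  qed
  also have "\<dots> = fact d * (of_int (\<Sum>p<N. n p) * (\<Prod>p<N. ifact (n p)))"
    unfolding sum_mult_prod_ifact[OF finite_lessThan] sum_distrib_left ..
  also have "\<dots> = fact (Suc d) * (\<Prod>p<N. ifact (n p))"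
    unfolding Suc.prems fact_Suc of_int_of_nat_eq by (simp only: mult_ac)
  finally show ?case .
qed

text \<open>Frobenius's dimension formula. For each \<open>s\<close> the colourings of the
  prescribed weight are counted by a multinomial coefficient, and the signed sum over
  \<open>s\<close> is the determinant \<open>kern\<close>.\<close>

lemma alt_coef_id:
  assumes l: "l \<in> compositions N (d + \<Sum>{..<N})"
  shows "of_int (alt_coef d N id l) = fact d * kern N (\<lambda>p. int (l p))"
proof -
  let ?P = "{s. s permutes {..<N}}"
  have F: "fixed_colourings d N id = colourings d N"
    by (simp add: fixed_colourings_def)
  have a: "alt_coef d N id l = (\<Sum>s\<in>?P. \<Sum>c\<in>colourings d N.
      if \<forall>p<N. weight d c p + (N - 1 - s p) = l p then sign s else 0)"
    unfolding alt_coef_def F by (rule sum.swap)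
  have "(of_int (alt_coef d N id l) :: rat) = (\<Sum>s\<in>?P. of_int (\<Sum>c\<in>colourings d N.
      if \<forall>p<N. weight d c p + (N - 1 - s p) = l p then sign s else 0))"
    unfolding a by (rule of_int_sum)
  also have "\<dots> = (\<Sum>s\<in>?P. fact d * (of_int (sign s) * (\<Prod>p<N. ifact (int (l p) - int (N - 1 - s p)))))"
  proof (rule sum.cong[OF refl])
    fix s assume s: "s \<in> ?P"
    have "(\<Sum>p<N. int (l p) - int (N - 1 - s p)) = int d"
    proof -
      have "(\<Sum>p<N. int (l p)) = int (d + \<Sum>{..<N})"
        using l by (simp add: compositions_def flip: of_nat_sum)
      moreover have "(\<Sum>p<N. int (N - 1 - s p)) = int (\<Sum>{..<N})"
        using sum_stair[of s N] s by simp
      ultimately show ?thesis by (simp only: sum_subtractf)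
    qed
    from card_colourings_of_weight[OF this]
    have "of_nat (card {c\<in>colourings d N. \<forall>p<N. int (weight d c p) = int (l p) - int (N - 1 - s p)}) =
        fact d * (\<Prod>p<N. ifact (int (l p) - int (N - 1 - s p)))" .
    moreover have "int (weight d c p) = int (l p) - int (N - 1 - s p) \<longleftrightarrow> weight d c p + (N - 1 - s p) = l p" for c p
      by linarith
    ultimately have c: "of_nat (card {c\<in>colourings d N. \<forall>p<N. weight d c p + (N - 1 - s p) = l p}) =
        fact d * (\<Prod>p<N. ifact (int (l p) - int (N - 1 - s p)))"
      by simp
    have "(\<Sum>c\<in>colourings d N. if \<forall>p<N. weight d c p + (N - 1 - s p) = l p then sign s else 0) =
        int (card {c\<in>colourings d N. \<forall>p<N. weight d c p + (N - 1 - s p) = l p}) * sign s"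
      by (simp add: sum.If_cases Int_def)
    then have "of_int (\<Sum>c\<in>colourings d N. if \<forall>p<N. weight d c p + (N - 1 - s p) = l p then sign s else 0) =
        (of_nat (card {c\<in>colourings d N. \<forall>p<N. weight d c p + (N - 1 - s p) = l p}) * of_int (sign s) :: rat)"
      by (simp only: of_int_mult of_int_of_nat_eq)
    then show "of_int (\<Sum>c\<in>colourings d N. if \<forall>p<N. weight d c p + (N - 1 - s p) = l p then sign s else 0) =
        fact d * (of_int (sign s) * (\<Prod>p<N. ifact (int (l p) - int (N - 1 - s p))))"
      unfolding c by (simp only: mult_ac)
  qed
  finally show ?thesis
    by (simp only: kern_def sum_distrib_left)
qed

section \<open>Words in transpositions\<close>

definition transposition_words :: "nat \<Rightarrow> nat \<Rightarrow> (nat \<Rightarrow> nat) list set" where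
  "transposition_words d b = {gs. length gs = b \<and> set gs \<subseteq> transpositions d}"

lemma transposition_permutes: "t \<in> transpositions d \<Longrightarrow> t permutes {1..d}"
  by (auto simp: transpositions_def intro: permutes_swap_id)

lemma finite_transpositions: "finite (transpositions d)"
  by (rule finite_subset[of _ "{p. p permutes {1..d}}"]) (use transposition_permutes in \<open>blast intro: finite_permutations\<close>)+

lemma finite_transposition_words: "finite (transposition_words d b)"
  using finite_lists_length_eq[OF finite_transpositions[of d], of b]
  by (simp add: transposition_words_def conj_commute)

lemma foldr_permutes: "set gs \<subseteq> transpositions d \<Longrightarrow> foldr (\<circ>) gs id permutes {1..d}"
  by (induction gs) (auto simp del: One_nat_def intro: permutes_compose transposition_permutes permutes_id)

lemma sum_transpositions:
  fixes f :: "(nat \<Rightarrow> nat) \<Rightarrow> 'a::comm_ring_1"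
  shows "(\<Sum>(i,j)\<in>{(i,j)\<in>{1..d}\<times>{1..d}. i \<noteq> j}. f (transpose i j)) = 2 * (\<Sum>t\<in>transpositions d. f t)"
proof -
  let ?P = "{(i,j)\<in>{1..d}\<times>{1..d}. i \<noteq> j}"
  let ?h = "\<lambda>(i,j). transpose i j :: nat \<Rightarrow> nat"
  have fP: "finite ?P" by (rule finite_subset[of _ "{1..d}\<times>{1..d}"]) auto
  have im: "?h ` ?P = transpositions d" by (auto simp: transpositions_def image_iff)
  have "card {a\<in>?P. ?h a = t} = 2" if tt: "t \<in> transpositions d" for t
  proof -
    obtain i j where t: "t = transpose i j" "i \<in> {1..d}" "j \<in> {1..d}" "i \<noteq> j"
      using tt unfolding transpositions_def by blast
    have "transpose k l = transpose i j \<longleftrightarrow> (k = i \<and> l = j) \<or> (k = j \<and> l = i)" if "k \<noteq> l" for k l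
    proof
      assume e: "transpose k l = transpose i j"
      have "transpose i j k = l" "transpose i j l = k"
        using fun_cong[OF e, of k] fun_cong[OF e, of l] by auto
      with that show "(k = i \<and> l = j) \<or> (k = j \<and> l = i)"
        by (auto simp: transpose_def split: if_splits)
    qed (auto simp: transpose_commute)
    then have "{a\<in>?P. ?h a = t} = {(i,j),(j,i)}"
      using t by auto
    then show ?thesis using t by simp
  qed
  then have "(\<Sum>t\<in>transpositions d. \<Sum>a\<in>{a\<in>?P. ?h a = t}. f (?h a)) = (\<Sum>t\<in>transpositions d. 2 * f t)"
    by (intro sum.cong refl) simp
  also have "(\<Sum>t\<in>transpositions d. \<Sum>a\<in>{a\<in>?P. ?h a = t}. f (?h a)) = (\<Sum>a\<in>?P. f (?h a))"
    using fP finite_transpositions im by (intro sum.group) auto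
  finally show ?thesis by (simp add: case_prod_unfold sum_distrib_left)
qed

lemma sum_words_alt_coef:
  assumes l: "l \<in> compositions N (d + \<Sum>{..<N})"
  shows "(\<Sum>gs\<in>transposition_words d b. of_int (alt_coef d N (foldr (\<circ>) gs id) l)) =
    (of_int (double_content N l) / 2) ^ b * (fact d * kern N (\<lambda>p. int (l p)))"
proof (induction b)
  case 0
  have "transposition_words d 0 = {[]}" by (auto simp: transposition_words_def)
  then show ?case using alt_coef_id[OF l] by (simp add: id_def)
next
  case (Suc b)
  let ?T = "transpositions d"
  have step: "(\<Sum>t\<in>?T. of_int (alt_coef d N (t \<circ> g) l) :: rat) = of_int (double_content N l) / 2 * of_int (alt_coef d N g l)"
    if g: "g permutes {1..d}" for g
  proof -
    have "2 * (\<Sum>t\<in>?T. alt_coef d N (t \<circ> g) l) = double_content N l * alt_coef d N g l"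
      using sum_transpositions[where d = d and f = "\<lambda>t. alt_coef d N (t \<circ> g) l"] sum_transpositions_alt_coef[OF g, of N l]
      by simp
    then have "(of_int (2 * (\<Sum>t\<in>?T. alt_coef d N (t \<circ> g) l)) :: rat) = of_int (double_content N l * alt_coef d N g l)"
      by (simp only:)
    then show ?thesis by (simp add: field_simps)
  qed
  have W: "transposition_words d (Suc b) = (\<lambda>(gs,t). t # gs) ` (transposition_words d b \<times> ?T)"
    by (auto simp: transposition_words_def length_Suc_conv image_iff)
  have "(\<Sum>gs\<in>transposition_words d (Suc b). of_int (alt_coef d N (foldr (\<circ>) gs id) l) :: rat) =
      (\<Sum>(gs,t)\<in>transposition_words d b \<times> ?T. of_int (alt_coef d N (t \<circ> foldr (\<circ>) gs id) l))"
    unfolding W by (subst sum.reindex) (auto simp: inj_on_def intro!: sum.cong)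
  also have "\<dots> = (\<Sum>gs\<in>transposition_words d b. \<Sum>t\<in>?T. of_int (alt_coef d N (t \<circ> foldr (\<circ>) gs id) l))"
    by (rule sum.cartesian_product[symmetric])
  also have "\<dots> = (\<Sum>gs\<in>transposition_words d b. of_int (double_content N l) / 2 * of_int (alt_coef d N (foldr (\<circ>) gs id) l))"
    by (intro sum.cong refl step foldr_permutes) (simp add: transposition_words_def)
  also have "\<dots> = (of_int (double_content N l) / 2) ^ Suc b * (fact d * kern N (\<lambda>p. int (l p)))"
    unfolding sum_distrib_left[symmetric] Suc.IH by (simp only: power_Suc mult.assoc)
  finally show ?case .
qed

text \<open>The Frobenius character formula: for $l_i = \lambda_i + N - 1 - i$ with $\lambda$ a partition of
  \<^term>\<open>d\<close>, the kernel is $\dim\lambda / d!$ and \<^const>\<open>double_content\<close> is twice the content sum;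
  every $\lambda$ occurs $N!$ times, once for each order of the exponents.\<close>

theorem Cov_eq_sum_kern:
  assumes d: "d \<le> N"
  shows "fact N * Cov d b =
    (\<Sum>l\<in>compositions N (d + \<Sum>{..<N}). (kern N (\<lambda>p. int (l p)))\<^sup>2 * (of_int (double_content N l) / 2) ^ b)"
proof -
  let ?W = "transposition_words d b" and ?C = "compositions N (d + \<Sum>{..<N})"
  let ?g = "\<lambda>gs. foldr (\<circ>) gs id :: nat \<Rightarrow> nat"
  let ?k = "\<lambda>l. kern N (\<lambda>p. int (l p))"
  have m: "simple_monodromies d b = {gs\<in>?W. ?g gs = id}"
    by (auto simp: simple_monodromies_def transposition_words_def)
  \<comment> \<open>One of the two kernels is kept for the pairing that detects the identity; the
    other is the dimension with which the iteration over words starts.\<close>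
  have "fact d * (\<Sum>l\<in>?C. (?k l)\<^sup>2 * (of_int (double_content N l) / 2) ^ b) =
      (\<Sum>l\<in>?C. ?k l * ((of_int (double_content N l) / 2) ^ b * (fact d * ?k l)))"
    unfolding sum_distrib_left power2_eq_square by (simp only: mult_ac)
  also have "\<dots> = (\<Sum>l\<in>?C. \<Sum>gs\<in>?W. ?k l * of_int (alt_coef d N (?g gs) l))"
    unfolding sum_distrib_left[symmetric]
    by (intro sum.cong refl arg_cong2[where f="(*)"] sum_words_alt_coef[symmetric])
  also have "\<dots> = (\<Sum>gs\<in>?W. \<Sum>l\<in>?C. ?k l * of_int (alt_coef d N (?g gs) l))"
    by (rule sum.swap)
  also have "\<dots> = (\<Sum>gs\<in>?W. fact N * (if ?g gs = id then 1 else 0))"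
  proof (rule sum.cong[OF refl])
    fix gs assume "gs \<in> ?W"
    then have g: "?g gs permutes {1..d}"
      by (intro foldr_permutes) (simp add: transposition_words_def)
    show "(\<Sum>l\<in>?C. ?k l * of_int (alt_coef d N (?g gs) l)) = fact N * (if ?g gs = id then 1 else 0)"
      unfolding sum_kern_alt_coef[OF g] sum_kern_fixed_colourings[OF g d] ..
  qed
  also have "\<dots> = fact N * of_nat (card (simple_monodromies d b))"
    unfolding m sum_distrib_left[symmetric] using finite_transposition_words[of d b]
    by (simp add: sum.If_cases Int_def)
  finally show ?thesis
    by (simp add: Cov_def field_simps)
qed

subsection \<open>The Toda equation for Hankel determinants\<close>

lemma derivation_prod:
  fixes D :: "'a::comm_ring_1 \<Rightarrow> 'a"
  assumes mult: "\<And>x y. D (x * y) = D x * y + x * D y" and "D 1 = 0" and "finite S"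
  shows "D (\<Prod>i\<in>S. f i) = (\<Sum>k\<in>S. \<Prod>i\<in>S. if i = k then D (f i) else f i)"
  using \<open>finite S\<close>
proof (induction S)
  case empty
  then show ?case by (simp add: \<open>D 1 = 0\<close>)
next
  case (insert a S)
  have *: "(\<Prod>i\<in>insert a S. if i = k then D (f i) else f i)
      = f a * (\<Prod>i\<in>S. if i = k then D (f i) else f i)" if "k \<in> S" for k
    using that insert by (subst prod.insert) auto
  have **: "(\<Prod>i\<in>insert a S. if i = a then D (f i) else f i) = D (f a) * (\<Prod>i\<in>S. f i)"
    using insert by (subst prod.insert) (auto intro!: prod.cong arg_cong2[where f="(*)"])
  have ***: "(\<Prod>i\<in>insert a S. f i) = f a * (\<Prod>i\<in>S. f i)"
    using insert by simp
  show ?case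
    by (simp only: sum.insert[OF insert.hyps] ** *** mult insert.IH sum_distrib_left * cong: sum.cong)
qed

lemma derivation_det:
  fixes D :: "'a::comm_ring_1 \<Rightarrow> 'a"
  assumes add: "\<And>x y. D (x + y) = D x + D y"
    and mult: "\<And>x y. D (x * y) = D x * y + x * D y"
  shows "D (det (mat n n (\<lambda>(i,j). A i j))) =
    (\<Sum>k<n. det (mat n n (\<lambda>(i,j). if i = k then D (A i j) else A i j)))"
proof -
  have D0: "D 0 = 0" using add[of 0 0] by simp
  have D1: "D 1 = 0" using mult[of 1 1] by simp
  have Dm: "D (- x) = - D x" for x using add[of x "- x"] D0 by (simp add: eq_neg_iff_add_eq_0 add.commute)
  have Ds: "D (sum f S) = (\<Sum>x\<in>S. D (f x))" for f and S :: "'b set"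
    by (induction S rule: infinite_finite_induct) (auto simp: D0 add)
  have Dsig: "D (signof p * x) = signof p * D x" for p x
    by (cases p rule: sign_cases) (auto simp: Dm)
  show ?thesis
    apply (simp add: det_def Ds Dsig derivation_prod[of D, OF mult D1] sum_distrib_left lessThan_atLeast0)
    apply (subst sum.swap, intro sum.cong refl arg_cong2[where f="(*)"] prod.cong)
    done
qed

text \<open>\<open>B\<close> consists of the first two columns of the adjugate and unit vectors.
  Then \<open>A * B\<close> is block upper triangular with \<open>det A\<close> twice on the
  diagonal followed by the inner block, so one factor \<open>det A\<close> cancels and the 2 by 2
  minor of the adjugate remains.\<close>

lemma desnanot_jacobi:
  fixes A :: "'a::idom mat"
  assumes A: "A \<in> carrier_mat (n + 2) (n + 2)" and nz: "det A \<noteq> 0"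
  shows "det A * det (mat n n (\<lambda>(i,j). A $$ (i + 2, j + 2))) =
    det (mat_delete A 0 0) * det (mat_delete A 1 1) - det (mat_delete A 0 1) * det (mat_delete A 1 0)"
proof -
  define adj where "adj = adj_mat A"
  have adj: "adj \<in> carrier_mat (n+2) (n+2)" "A * adj = det A \<cdot>\<^sub>m 1\<^sub>m (n+2)"
    using adj_mat[OF A] by (auto simp: adj_def)
  have adjij: "adj $$ (i,j) = cofactor A j i" if "i < n+2" "j < n+2" for i j
    using A that by (simp add: adj_def adj_mat_def)
  define B1 where "B1 = mat 2 2 (\<lambda>(i,j). adj $$ (i,j))"
  define B3 where "B3 = mat n 2 (\<lambda>(i,j). adj $$ (i+2,j))"
  define B where "B = four_block_mat B1 (0\<^sub>m 2 n) B3 (1\<^sub>m n)"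
  define C2 where "C2 = mat 2 n (\<lambda>(i,j). A $$ (i,j+2))"
  define C4 where "C4 = mat n n (\<lambda>(i,j). A $$ (i+2,j+2))"
  define C where "C = four_block_mat (det A \<cdot>\<^sub>m 1\<^sub>m 2) C2 (0\<^sub>m n 2) C4"
  have Bc: "B \<in> carrier_mat (n+2) (n+2)" "C \<in> carrier_mat (n+2) (n+2)"
    by (auto simp: B_def B1_def B3_def C_def C2_def C4_def)
  have Bentry: "B $$ (i,j) = (if j < 2 then adj $$ (i,j) else if i = j then 1 else 0)"
    if "i < n+2" "j < n+2" for i j
    using that by (auto simp: B_def B1_def B3_def numeral_2_eq_2 Suc_diff_Suc)
  have sub2: "Suc (Suc (k - 2)) = k" if "\<not> k < 2" for k :: nat
    using that by simp
  have AB: "A * B = C"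
  proof (rule eq_matI)
    fix i j assume "i < dim_row C" "j < dim_col C"
    then have ij: "i < n+2" "j < n+2" using Bc by auto
    have e: "(A * B) $$ (i,j) = (\<Sum>k<n+2. A $$ (i,k) * B $$ (k,j))"
      using A Bc ij by (simp add: scalar_prod_def lessThan_atLeast0 del: sum.op_ivl_Suc)
    show "(A * B) $$ (i,j) = C $$ (i,j)"
    proof (cases "j < 2")
      case True
      have "(A * B) $$ (i,j) = (\<Sum>k<n+2. A $$ (i,k) * adj $$ (k,j))"
        unfolding e using ij True by (intro sum.cong) (auto simp: Bentry)
      also have "\<dots> = (A * adj) $$ (i,j)"
        using A adj(1) ij by (simp add: scalar_prod_def lessThan_atLeast0 del: sum.op_ivl_Suc)
      also have "\<dots> = C $$ (i,j)"
        unfolding adj(2) using ij True by (auto simp: C_def C2_def C4_def)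
      finally show ?thesis .
    next
      case False
      have "(A * B) $$ (i,j) = (\<Sum>k<n+2. if k = j then A $$ (i,k) else 0)"
        unfolding e using ij False by (intro sum.cong) (auto simp: Bentry)
      also have "\<dots> = A $$ (i,j)"
        using ij by (simp add: sum.delta)
      also have "\<dots> = C $$ (i,j)"
        using ij False by (auto simp: C_def C2_def C4_def sub2)
      finally show ?thesis .
    qed
  qed (use A Bc in auto)
  have dB: "det B = det B1"
    unfolding B_def by (subst det_four_block_mat_upper_right_zero[of _ 2 _ n]) (auto simp: B1_def B3_def)
  have dC: "det C = (det A)\<^sup>2 * det C4"
    unfolding C_def by (subst det_four_block_mat_lower_left_zero[of _ 2 _ n]) (auto simp: C2_def C4_def)
  have dB1: "det B1 = adj $$ (0,0) * adj $$ (1,1) - adj $$ (0,1) * adj $$ (1,0)"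
  proof -
    have "det B1 = (\<Sum>i<2. B1 $$ (i,0) * cofactor B1 i 0)"
      by (rule laplace_expansion_column) (auto simp: B1_def)
    also have "\<dots> = B1 $$ (0,0) * B1 $$ (1,1) - B1 $$ (1,0) * B1 $$ (0,1)"
      by (simp add: cofactor_def det_single mat_delete_def B1_def numeral_2_eq_2)
    finally show ?thesis
      by (simp add: B1_def)
  qed
  have "det A * det B = det C"
    unfolding AB[symmetric] by (rule det_mult[OF A Bc(1), symmetric])
  then have "det B1 = det A * det C4"
    using nz by (simp add: dB dC power2_eq_square mult.assoc)
  then show ?thesis
    by (simp add: dB1 C4_def adjij cofactor_def mult_ac)
qed

text \<open>The row indices \<open>f\<close> descend in steps of one, so differentiating any row but
  the topmost reproduces the row above it and the determinant vanishes.\<close>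

lemma det_hankel_deriv:
  fixes D :: "'a::comm_ring_1 \<Rightarrow> 'a"
  assumes add: "\<And>x y. D (x + y) = D x + D y"
    and mult: "\<And>x y. D (x * y) = D x * y + x * D y"
    and Dm: "\<And>k. D (m k) = m (Suc k)"
    and f: "\<And>i. Suc i < n \<Longrightarrow> Suc (f (Suc i)) = f i"
    and n: "n > 0"
  shows "D (det (mat n n (\<lambda>(i,j). m (f i + g j)))) =
    det (mat n n (\<lambda>(i,j). m ((if i = 0 then Suc (f 0) else f i) + g j)))"
proof -
  have "det (mat n n (\<lambda>(i,j). if i = k then D (m (f i + g j)) else m (f i + g j))) = 0"
    if k: "k \<in> {..<n} - {0}" for k
  proof (rule det_identical_rows[of _ n "k - 1" k])
    show "row (mat n n (\<lambda>(i,j). if i = k then D (m (f i + g j)) else m (f i + g j))) (k - 1) =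
      row (mat n n (\<lambda>(i,j). if i = k then D (m (f i + g j)) else m (f i + g j))) k"
    proof -
      have "f (k - Suc 0) = Suc (f k)"
        using k f[of "k - 1"] by auto
      then show ?thesis
        using k by (intro eq_vecI) (auto simp: Dm)
    qed
  qed (use k in auto)
  then have "D (det (mat n n (\<lambda>(i,j). m (f i + g j)))) =
    det (mat n n (\<lambda>(i,j). if i = 0 then D (m (f i + g j)) else m (f i + g j)))"
    using n by (simp add: derivation_det[of D, OF add mult] sum.remove[of _ 0])
  also have "\<dots> = det (mat n n (\<lambda>(i,j). m ((if i = 0 then Suc (f 0) else f i) + g j)))"
    by (intro arg_cong[where f=det] eq_matI) (auto simp: Dm)
  finally show ?thesis .
qed

text \<open>Deleting index 0 from n + 1, ..., 0 leaves the indices of \<open>H (Suc n)\<close>;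
  deleting index 1 leaves n + 1, n - 1, ..., 0, called \<open>r\<close>, which is what one
  differentiation produces. The minors in the Desnanot-Jacobi identity are thus the determinant and
  its first two derivatives.\<close>

lemma hankel_toda:
  fixes D :: "'a::idom \<Rightarrow> 'a" and m :: "nat \<Rightarrow> 'a"
  defines "H \<equiv> \<lambda>n. mat n n (\<lambda>(i,j). m ((n - 1 - i) + (n - 1 - j)))"
  assumes add: "\<And>x y. D (x + y) = D x + D y"
    and mult: "\<And>x y. D (x * y) = D x * y + x * D y"
    and Dm: "\<And>k. D (m k) = m (Suc k)"
    and nz: "det (H (Suc (Suc n))) \<noteq> 0"
  shows "det (H (Suc n)) * D (D (det (H (Suc n)))) - (D (det (H (Suc n))))\<^sup>2 =
    det (H (Suc (Suc n))) * det (H n)"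
proof -
  define A where "A = H (Suc (Suc n))"
  define r where "r = (\<lambda>i. if i = 0 then Suc n else n - i)"
  define M where "M = (\<lambda>f g. mat (Suc n) (Suc n) (\<lambda>(i,j). m (f i + g j)))"
  have A: "A \<in> carrier_mat (n + 2) (n + 2)"
    by (simp add: A_def H_def)
  have Mt: "det (M f g) = det (M g f)" for f g
  proof -
    have "transpose_mat (M f g) = M g f"
      by (intro eq_matI) (simp_all add: M_def add.commute)
    then show ?thesis
      using det_transpose[of "M f g" "Suc n"] by (simp add: M_def)
  qed
  have 1: "D (det (M (\<lambda>i. n - i) g)) = det (M r g)" for g
    unfolding M_def r_def
    by (subst det_hankel_deriv[where D = D and m = m, OF add mult Dm]) (auto intro!: arg_cong[where f=det])
  have d00: "mat_delete A 0 0 = M (\<lambda>i. n - i) (\<lambda>i. n - i)"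
    by (intro eq_matI) (auto simp: mat_delete_def A_def H_def M_def)
  have d01: "mat_delete A 0 1 = M (\<lambda>i. n - i) r"
    by (intro eq_matI; auto simp: mat_delete_def A_def H_def M_def r_def; simp add: add.commute)
  have d10: "mat_delete A 1 0 = M r (\<lambda>i. n - i)"
    by (intro eq_matI; auto simp: mat_delete_def A_def H_def M_def r_def; simp add: add.commute)
  have d11: "mat_delete A 1 1 = M r r"
    by (intro eq_matI; auto simp: mat_delete_def A_def H_def M_def r_def; simp add: add.commute Suc_diff_le)
  have Hs: "H (Suc n) = M (\<lambda>i. n - i) (\<lambda>i. n - i)"
    by (intro eq_matI) (auto simp: H_def M_def)
  have Hn: "mat n n (\<lambda>(i,j). A $$ (i + 2, j + 2)) = H n"
    by (intro eq_matI) (auto simp: H_def A_def)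
  have D1: "D (det (H (Suc n))) = det (M r (\<lambda>i. n - i))"
    by (simp add: Hs 1)
  have D2: "D (det (M r (\<lambda>i. n - i))) = det (M r r)"
    unfolding Mt[of r "\<lambda>i. n - i"] by (rule 1)
  show ?thesis
    using desnanot_jacobi[OF A] nz unfolding D1 D2 Hn d00 d01 d10 d11
    by (simp add: A_def Hs power2_eq_square Mt[of "\<lambda>i. n - i" r])
qed

subsection \<open>The logarithmic form\<close>

lemma deriv_u_eq: "deriv_u f = fps_X * fps_deriv f"
proof (rule fps_ext)
  show "fps_nth (deriv_u f) n = fps_nth (fps_X * fps_deriv f) n" for n
    by (cases n) (simp_all add: deriv_u_def)
qed

lemma deriv_u_add: "deriv_u (f + g) = deriv_u f + deriv_u g"
  by (simp add: deriv_u_eq algebra_simps)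

lemma deriv_u_mult: "deriv_u (f * g) = deriv_u f * g + f * deriv_u g"
  by (simp add: deriv_u_eq algebra_simps)

text \<open>The embedded series has derivative 1/(1 + X), as the product with 1 + X shows; composing
  that product with \<open>f - 1\<close> gives the inverse of \<open>f\<close>.\<close>

lemma mult_deriv_u_log_series:
  assumes f: "fps_nth f 0 = 1"
  shows "f * deriv_u (log_series f) = deriv_u f"
proof -
  define l where "l = Abs_fps (\<lambda>n. fps_const (fps_nth (fps_ln (1::rat)) n))"
  have f0: "fps_nth (f - 1) 0 = 0" using f by simp
  have nth: "fps_nth (fps_deriv l) n = fps_const ((- 1) ^ n)" for n
  proof -
    have "of_nat (n + 1) * fps_const ((- 1) ^ n / of_nat (n + 1) :: rat) = fps_const ((- 1) ^ n)"
      by (simp only: fps_of_nat[symmetric] fps_const_mult) simp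
    then show ?thesis
      by (simp add: l_def fps_ln_def)
  qed
  have "(1 + fps_X) * fps_deriv l = 1"
  proof (rule fps_ext)
    show "fps_nth ((1 + fps_X) * fps_deriv l) n = fps_nth 1 n" for n
      by (cases n) (simp_all add: nth ring_distribs del: fps_deriv_nth flip: fps_const_neg)
  qed
  then have "((1 + fps_X) * fps_deriv l) oo (f - 1) = 1 oo (f - 1)" by simp
  then have *: "f * (fps_deriv l oo (f - 1)) = 1"
    by (simp add: fps_compose_mult_distrib[OF f0] fps_compose_add_distrib fps_X_fps_compose_startby0[OF f0])
  have "deriv_u (log_series f) = fps_X * ((fps_deriv l oo (f - 1)) * fps_deriv (f - 1))"
    by (simp add: log_series_def deriv_u_eq l_def[symmetric] fps_compose_deriv[OF f0])
  then have "f * deriv_u (log_series f) = (f * (fps_deriv l oo (f - 1))) * (fps_X * fps_deriv f)"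
    by (simp add: mult_ac)
  then show ?thesis by (simp add: * deriv_u_eq)
qed

text \<open>Differentiating \<open>tau * L = deriv_u tau\<close>, with \<open>L\<close> the
  logarithmic derivative, shows that the bilinear form is the square of \<open>tau\<close> times
  \<open>deriv_u L\<close>. The factor \<open>fps_X\<close>, which is e^u, is then cancelled in
  Laurent series.\<close>

lemma toda_log_form:
  assumes toda: "tau * deriv_u (deriv_u tau) - (deriv_u tau)\<^sup>2 = fps_X * R"
  shows "fls_X_inv * fps_to_fls (deriv_u (deriv_u (log_series tau))) = fps_to_fls (R / tau\<^sup>2)"
proof -
  define L where "L = deriv_u (log_series tau)"
  have 1: "tau * L = deriv_u tau"
    unfolding L_def by (rule mult_deriv_u_log_series[OF tau_nth_0])
  then have "deriv_u (deriv_u tau) = deriv_u tau * L + tau * deriv_u L"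
    by (metis deriv_u_mult)
  then have "tau * deriv_u (deriv_u tau) = deriv_u tau * (tau * L) + tau\<^sup>2 * deriv_u L"
    by (simp only: ring_distribs power2_eq_square mult_ac)
  then have "tau\<^sup>2 * deriv_u L = fps_X * R"
    using toda by (simp add: 1 power2_eq_square)
  also have "\<dots> = tau\<^sup>2 * (fps_X * (R / tau\<^sup>2))"
    using divide_tau_mult[of R] by (metis mult.commute mult.left_commute)
  finally have "deriv_u L = fps_X * (R / tau\<^sup>2)"
    using tau_nth_0 by auto
  then show ?thesis
    unfolding L_def[symmetric]
    by (simp add: fls_times_fps_to_fls fls_X_inv_times_conv_shift fls_X_times_conv_shift)
qed

subsection \<open>Moments of the Plancherel weight\<close>

definition falling :: "nat \<Rightarrow> rat poly" where
  "falling k = (\<Prod>m<k. [:- of_nat m, 1:])"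

lemma ifact_diff: "ifact (int n - int k) = poly (falling k) (of_nat n) * ifact (int n)"
proof (induction k)
  case (Suc k)
  have "ifact (int n - int (Suc k)) = ifact ((int n - int k) - 1)"
    by (simp add: algebra_simps)
  also have "\<dots> = of_int (int n - int k) * ifact (int n - int k)"
    by (rule of_int_mult_ifact[symmetric])
  also have "\<dots> = (of_nat n - of_nat k) * (poly (falling k) (of_nat n) * ifact (int n))"
    by (simp add: Suc.IH)
  also have "\<dots> = poly (falling (Suc k)) (of_nat n) * ifact (int n)"
    by (simp add: falling_def algebra_simps)
  finally show ?case .
qed (simp add: falling_def)

lemma degree_falling: "degree (falling k) = k"
  unfolding falling_def by (subst degree_prod_eq_sum_degree) auto

lemma lead_coeff_falling: "coeff (falling k) k = 1"
proof -
  have "lead_coeff (falling k) = 1"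
    unfolding falling_def by (simp add: lead_coeff_prod)
  then show ?thesis by (simp add: degree_falling)
qed

text \<open>\<open>falling (N - 1 - j)\<close> is monic of degree N - 1 - j, so the two matrices
  differ by a unitriangular factor.\<close>

lemma det_falling:
  "det (mat N N (\<lambda>(i,j). poly (falling (N - 1 - j)) (x i))) = det (mat N N (\<lambda>(i,j). x i ^ (N - 1 - j)))"
proof -
  let ?X = "mat N N (\<lambda>(i,j). x i ^ (N - 1 - j))"
  let ?U = "mat N N (\<lambda>(j,k). coeff (falling (N - 1 - k)) (N - 1 - j))"
  have rev: "bij_betw (\<lambda>p. N - 1 - p) {..<N} {..<N}"
    by (rule bij_betw_byWitness[where f' = "\<lambda>p. N - 1 - p"]) auto
  have "mat N N (\<lambda>(i,j). poly (falling (N - 1 - j)) (x i)) = ?X * ?U"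
  proof (rule eq_matI)
    fix i j assume "i < dim_row (?X * ?U)" "j < dim_col (?X * ?U)"
    then have ij: "i < N" "j < N" by auto
    have "poly (falling (N - 1 - j)) (x i) = (\<Sum>m<N. coeff (falling (N - 1 - j)) m * x i ^ m)"
      unfolding poly_altdef degree_falling
      by (rule sum.mono_neutral_left) (use ij in \<open>auto simp: coeff_eq_0 degree_falling\<close>)
    also have "\<dots> = (\<Sum>m<N. coeff (falling (N - 1 - j)) (N - 1 - m) * x i ^ (N - 1 - m))"
      by (rule sum.reindex_bij_betw[OF rev, symmetric])
    also have "\<dots> = (?X * ?U) $$ (i,j)"
      using ij by (simp add: scalar_prod_def lessThan_atLeast0 mult.commute)
    finally show "mat N N (\<lambda>(i,j). poly (falling (N - 1 - j)) (x i)) $$ (i,j) = (?X * ?U) $$ (i,j)"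
      using ij by simp
  qed auto
  moreover have "det ?U = 1"
  proof -
    have "det ?U = prod_list (diag_mat ?U)"
    proof (rule det_lower_triangular[of N])
      fix i j assume "i < j" "j < N"
      then show "?U $$ (i,j) = 0"
        by (simp add: coeff_eq_0 degree_falling)
    qed simp
    also have "diag_mat ?U = replicate N 1"
      by (intro nth_equalityI) (auto simp: diag_mat_def lead_coeff_falling)
    finally show ?thesis by simp
  qed
  ultimately show ?thesis
    using det_mult[of ?X N ?U] by simp
qed

lemma vand_eq_det: "vand N x = det (mat N N (\<lambda>(i,j). x i ^ (N - 1 - j)))"
proof -
  have "det (mat N N (\<lambda>(i,j). x i ^ (N - 1 - j))) =
      (\<Sum>p | p permutes {0..<N}. of_int (sign p) * (\<Prod>i = 0..<N. mat N N (\<lambda>(i,j). x i ^ (N - 1 - j)) $$ (i, p i)))"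
    by (rule det_def') simp
  also have "\<dots> = vand N x"
    unfolding vand_def lessThan_atLeast0
  proof (intro sum.cong refl arg_cong2[where f="(*)"] prod.cong)
    fix p i assume "p \<in> {p. p permutes {0..<N}}" "i \<in> {0..<N}"
    then show "mat N N (\<lambda>(i,j). x i ^ (N - 1 - j)) $$ (i, p i) = x i ^ (N - 1 - p i)"
      using permutes_in_image[of p "{0..<N}" i] by simp
  qed
  finally show ?thesis by simp
qed

text \<open>Taking the factor 1/(l_i)! out of each row leaves falling factorials, which column
  operations turn into powers. This is the product form k(l), needed for Andreief's
  identity.\<close>

lemma kern_eq_vand:
  "kern N (\<lambda>p. int (l p)) = vand N (\<lambda>p. of_nat (l p)) * (\<Prod>p<N. ifact (int (l p)))"
proof -
  have "vand N (\<lambda>p. of_nat (l p)) = det (mat N N (\<lambda>(i,j). poly (falling (N - 1 - j)) (of_nat (l i) :: rat)))"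
    unfolding vand_eq_det by (rule det_falling[symmetric])
  also have "\<dots> = (\<Sum>p | p permutes {0..<N}. of_int (sign p) *
      (\<Prod>i = 0..<N. mat N N (\<lambda>(i,j). poly (falling (N - 1 - j)) (of_nat (l i))) $$ (i, p i)))"
    by (rule det_def') simp
  also have "\<dots> = (\<Sum>p | p permutes {..<N}. of_int (sign p) * (\<Prod>i<N. poly (falling (N - 1 - p i)) (of_nat (l i))))"
    unfolding lessThan_atLeast0
  proof (intro sum.cong refl arg_cong2[where f="(*)"] prod.cong)
    fix p i assume "p \<in> {p. p permutes {0..<N}}" "i \<in> {0..<N}"
    then show "mat N N (\<lambda>(i,j). poly (falling (N - 1 - j)) (of_nat (l i))) $$ (i, p i) =
        poly (falling (N - 1 - p i)) (of_nat (l i))"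
      using permutes_in_image[of p "{0..<N}" i] by simp
  qed
  finally have v: "vand N (\<lambda>p. of_nat (l p)) = \<dots>" .
  show ?thesis
    unfolding v kern_def sum_distrib_right ifact_diff prod.distrib by (simp only: mult.assoc)
qed

text \<open>Expanding both Vandermonde factors makes the sum over \<open>l\<close> factor into
  moments for each pair of permutations; reindexing by the first permutation yields the same
  determinant n! times.\<close>

lemma andreief:
  fixes x w :: "nat \<Rightarrow> 'a::comm_ring_1"
  shows "(\<Sum>l\<in>{..<n} \<rightarrow>\<^sub>E {..<L}. (vand n (\<lambda>i. x (l i)))\<^sup>2 * (\<Prod>i<n. w (l i))) =
    of_nat (fact n) * det (mat n n (\<lambda>(i,j). \<Sum>a<L. x a ^ ((n - 1 - i) + (n - 1 - j)) * w a))"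
proof -
  let ?P = "{s. s permutes {..<n}}" and ?E = "{..<n} \<rightarrow>\<^sub>E {..<L}"
  let ?m = "\<lambda>k. \<Sum>a<L. x a ^ k * w a"
  let ?e = "\<lambda>i. n - 1 - i"
  have "(\<Sum>l\<in>?E. (vand n (\<lambda>i. x (l i)))\<^sup>2 * (\<Prod>i<n. w (l i))) =
      (\<Sum>l\<in>?E. \<Sum>s\<in>?P. \<Sum>t\<in>?P. of_int (sign s) * of_int (sign t) *
        (\<Prod>i<n. x (l i) ^ (?e (s i) + ?e (t i)) * w (l i)))"
    unfolding power2_eq_square vand_def sum_product
    unfolding sum_distrib_right power_add prod.distrib
    by (simp only: mult_ac)
  also have "\<dots> = (\<Sum>s\<in>?P. \<Sum>l\<in>?E. \<Sum>t\<in>?P. of_int (sign s) * of_int (sign t) *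
        (\<Prod>i<n. x (l i) ^ (?e (s i) + ?e (t i)) * w (l i)))"
    by (rule sum.swap)
  also have "\<dots> = (\<Sum>s\<in>?P. \<Sum>t\<in>?P. \<Sum>l\<in>?E. of_int (sign s) * of_int (sign t) *
        (\<Prod>i<n. x (l i) ^ (?e (s i) + ?e (t i)) * w (l i)))"
    by (intro sum.cong refl sum.swap)
  also have "\<dots> = (\<Sum>s\<in>?P. \<Sum>t\<in>?P. of_int (sign s) * of_int (sign t) * (\<Prod>i<n. ?m (?e (s i) + ?e (t i))))"
    unfolding sum_distrib_left[symmetric]
    by (intro sum.cong refl arg_cong2[where f="(*)"] prod_sum_PiE[symmetric]) auto
  also have "\<dots> = (\<Sum>s\<in>?P. det (mat n n (\<lambda>(i,j). ?m (?e i + ?e j))))"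
  proof (rule sum.cong[OF refl])
    fix s assume "s \<in> ?P"
    then have s: "s permutes {..<n}" by simp
    have ps: "permutation s" using s permutation_permutes by blast
    have "(\<Sum>t\<in>?P. of_int (sign s) * of_int (sign t) * (\<Prod>i<n. ?m (?e (s i) + ?e (t i)))) =
        (\<Sum>t\<in>?P. of_int (sign t) * (\<Prod>i<n. ?m (?e i + ?e (t i))))"
    proof (rule sum.reindex_bij_witness[where i = "\<lambda>t. t \<circ> s" and j = "\<lambda>t. t \<circ> inv s"])
      fix t assume "t \<in> ?P"
      then have t: "t permutes {..<n}" by simp
      have pt: "permutation t" using t permutation_permutes by blast
      show "t \<circ> inv s \<circ> s = t" "t \<circ> s \<circ> inv s = t"
        using permutes_inv_o[OF s] by (simp_all add: comp_assoc)
      show "t \<circ> inv s \<in> ?P" "t \<circ> s \<in> ?P"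
        using permutes_compose[OF permutes_inv[OF s] t] permutes_compose[OF s t] by simp_all
      have "(\<Prod>i<n. ?m (?e i + ?e ((t \<circ> inv s) i))) = (\<Prod>i<n. ?m (?e (s i) + ?e ((t \<circ> inv s) (s i))))"
        by (rule prod.reindex_bij_betw[OF permutes_imp_bij[OF s], symmetric])
      then have "(\<Prod>i<n. ?m (?e i + ?e ((t \<circ> inv s) i))) = (\<Prod>i<n. ?m (?e (s i) + ?e (t i)))"
        by (simp add: permutes_inverses[OF s])
      moreover have "sign (t \<circ> inv s) = sign s * sign t"
        using ps pt by (simp add: sign_compose permutation_inverse sign_inverse)
      ultimately show "of_int (sign (t \<circ> inv s)) * (\<Prod>i<n. ?m (?e i + ?e ((t \<circ> inv s) i))) =
          of_int (sign s) * of_int (sign t) * (\<Prod>i<n. ?m (?e (s i) + ?e (t i)))"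
        by (simp only: of_int_mult)
    qed
    also have "\<dots> = (\<Sum>t | t permutes {0..<n}. of_int (sign t) *
        (\<Prod>i = 0..<n. mat n n (\<lambda>(i,j). ?m (?e i + ?e j)) $$ (i, t i)))"
      unfolding lessThan_atLeast0
    proof (intro sum.cong refl arg_cong2[where f="(*)"] prod.cong)
      fix p i assume "p \<in> {p. p permutes {0..<n}}" "i \<in> {0..<n}"
      then show "(\<Sum>a = 0..<L. x a ^ (?e i + ?e (p i)) * w a) =
          mat n n (\<lambda>(i,j). \<Sum>a = 0..<L. x a ^ (?e i + ?e j) * w a) $$ (i, p i)"
        using permutes_in_image[of p "{0..<n}" i] by simp
    qed
    also have "\<dots> = det (mat n n (\<lambda>(i,j). ?m (?e i + ?e j)))"
      by (rule det_def'[symmetric]) simp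
    finally show "(\<Sum>t\<in>?P. of_int (sign s) * of_int (sign t) * (\<Prod>i<n. ?m (?e (s i) + ?e (t i)))) = \<dots>" .
  qed
  also have "\<dots> = of_nat (fact n) * det (mat n n (\<lambda>(i,j). ?m (?e i + ?e j)))"
    using card_permutations[of "{..<n}" n] by simp
  finally show ?thesis .
qed

section \<open>Hankel determinants as generating functions\<close>

lemma kern_small:
  assumes "(\<Sum>i<N. l i) < \<Sum>{..<N}"
  shows "kern N (\<lambda>p. int (l p)) = 0"
proof (rule ccontr)
  assume "kern N (\<lambda>p. int (l p)) \<noteq> 0"
  then have "inj_on l {..<N}"
    by (intro inj_onI) (metis kern_not_inj lessThan_iff)
  then have "\<Sum>{..<N} \<le> (\<Sum>i<N. l i)"
    using sum_lessThan_card_le[of "l ` {..<N}"] by (simp add: card_image sum.reindex)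
  with assms show False by simp
qed

text \<open>The share of a single entry a = l_i: the squared reciprocal factorial belongs to k(l)^2,
  the exponential to the content sum, and \<open>fps_X ^ a\<close> marks the degree up to the
  staircase sum.\<close>

definition toda_weight :: "nat \<Rightarrow> nat \<Rightarrow> rat fps fps" where
  "toda_weight N a = fps_const (fps_const ((ifact (int a))\<^sup>2) *
     fps_exp (of_int (int a * (int a + 1 - 2 * int N)) / 2)) * fps_X ^ a"

text \<open>The cut at \<open>L\<close> makes Andreief's identity a finite one; the weight of
  \<open>a\<close> starts in degree \<open>a\<close>, so coefficients below degree \<open>L\<close>
  do not see it.\<close>

definition moment :: "nat \<Rightarrow> nat \<Rightarrow> nat \<Rightarrow> rat fps fps" where
  "moment N L k = (\<Sum>a<L. of_nat a ^ k * toda_weight N a)"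

definition hankel :: "nat \<Rightarrow> nat \<Rightarrow> nat \<Rightarrow> rat fps fps" where
  "hankel N L n = det (mat n n (\<lambda>(i,j). moment N L ((n - 1 - i) + (n - 1 - j))))"

lemma deriv_u_moment: "deriv_u (moment N L k) = moment N L (Suc k)"
proof -
  have const: "of_nat a ^ k = (fps_const (of_nat a ^ k) :: rat fps fps)" for a
    by (simp add: fps_const_power[symmetric] fps_of_nat del: fps_const_power)
  have "deriv_u (fps_const c * fps_X ^ a) = of_nat a * (fps_const c * fps_X ^ a)" for c :: "rat fps" and a
    by (rule fps_ext) (simp add: deriv_u_def fps_of_nat[symmetric] del: fps_of_nat)
  then have "deriv_u (of_nat a ^ k * toda_weight N a) = of_nat a * (of_nat a ^ k * toda_weight N a)" for a
    unfolding toda_weight_def const mult.assoc[symmetric] fps_const_mult by simp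
  moreover have "deriv_u (sum f A) = (\<Sum>a\<in>A. deriv_u (f a))" for f :: "nat \<Rightarrow> rat fps fps" and A
    by (simp add: deriv_u_eq fps_deriv_sum sum_distrib_left)
  ultimately show ?thesis
    unfolding moment_def by (simp only: power_Suc mult.assoc)
qed

lemma vand_of_nat_fps:
  "vand n (\<lambda>i. of_nat (l i) :: rat fps fps) = fps_const (fps_const (vand n (\<lambda>i. of_nat (l i))))"
proof -
  have nat: "(of_nat k :: rat fps fps) = fps_const (fps_const (of_nat k))" for k
    by (simp add: fps_of_nat)
  have pow: "(fps_const (fps_const c) :: rat fps fps) ^ k = fps_const (fps_const (c ^ k))" for c k
    by (simp add: fps_const_power)
  have prod: "(\<Prod>i\<in>A. fps_const (fps_const (f i))) = (fps_const (fps_const (\<Prod>i\<in>A. f i)) :: rat fps fps)" for f and A :: "nat set"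
    by (induction A rule: infinite_finite_induct) auto
  have sum: "(\<Sum>i\<in>A. fps_const (fps_const (f i))) = (fps_const (fps_const (\<Sum>i\<in>A. f i)) :: rat fps fps)" for f and A :: "(nat \<Rightarrow> nat) set"
    by (induction A rule: infinite_finite_induct) auto
  have int: "(of_int z :: rat fps fps) = fps_const (fps_const (of_int z))" for z
    by (simp add: fps_of_int)
  show ?thesis
    unfolding vand_def nat pow prod int fps_const_mult sum ..
qed

lemma prod_toda_weight:
  fixes n :: nat and l :: "nat \<Rightarrow> nat"
  shows "(\<Prod>i<n. toda_weight N (l i)) = fps_const (fps_const ((\<Prod>i<n. ifact (int (l i)))\<^sup>2) *
    fps_exp (of_int (\<Sum>i<n. int (l i) * (int (l i) + 1 - 2 * int N)) / 2)) * fps_X ^ (\<Sum>i<n. l i)"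
proof (induction n)
  case (Suc n)
  show ?case
    unfolding prod.lessThan_Suc Suc.IH
    unfolding toda_weight_def sum.lessThan_Suc of_int_add add_divide_distrib
      fps_exp_add_mult power_add power_mult_distrib fps_const_mult[symmetric]
    by (simp only: mult_ac)
qed simp

lemma fact_mult_hankel_nth:
  assumes "m < L"
  shows "of_nat (fact n) * fps_nth (hankel N L n) m = (\<Sum>l\<in>compositions n m.
    fps_const ((kern n (\<lambda>p. int (l p)))\<^sup>2) * fps_exp (of_int (\<Sum>i<n. int (l i) * (int (l i) + 1 - 2 * int N)) / 2))"
proof -
  let ?F = "\<lambda>l. fps_const ((kern n (\<lambda>p. int (l p)))\<^sup>2) * fps_exp (of_int (\<Sum>i<n. int (l i) * (int (l i) + 1 - 2 * int N)) / 2)"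
  let ?E = "{..<n} \<rightarrow>\<^sub>E {..<L}"
  have "of_nat (fact n) * hankel N L n = (\<Sum>l\<in>?E. (vand n (\<lambda>i. of_nat (l i)))\<^sup>2 * (\<Prod>i<n. toda_weight N (l i)))"
    unfolding hankel_def moment_def by (rule andreief[symmetric])
  also have "\<dots> = (\<Sum>l\<in>?E. fps_const (?F l) * fps_X ^ (\<Sum>i<n. l i))"
    unfolding vand_of_nat_fps prod_toda_weight kern_eq_vand power_mult_distrib fps_const_mult[symmetric] fps_const_power
    by (simp only: mult_ac)
  finally have eq: "of_nat (fact n) * hankel N L n = \<dots>" .
  have nth: "fps_nth (fps_const c * fps_X ^ k) m = (if k = m then c else 0)" for c :: "rat fps" and k
    by auto
  have "fps_nth (of_nat (fact n) * hankel N L n) m = (\<Sum>l\<in>?E. if (\<Sum>i<n. l i) = m then ?F l else 0)"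
    unfolding eq fps_sum_nth nth ..
  also have "\<dots> = (\<Sum>l\<in>{l\<in>?E. (\<Sum>i<n. l i) = m}. ?F l)"
    by (rule sum.inter_filter[symmetric]) (auto intro!: finite_PiE)
  also have "\<dots> = (\<Sum>l\<in>compositions n m. ?F l)"
  proof (rule sum.reindex_bij_witness[where i = "\<lambda>l. restrict l {..<n}" and j = "\<lambda>l i. if i < n then l i else 0"])
    fix l assume l: "l \<in> {l\<in>?E. (\<Sum>i<n. l i) = m}"
    then show "restrict (\<lambda>i. if i < n then l i else 0) {..<n} = l"
      by (auto simp: fun_eq_iff PiE_def extensional_def)
    show "(\<lambda>i. if i < n then l i else 0) \<in> compositions n m"
      using l by (simp add: compositions_def)
    have "kern n (\<lambda>p. int (if p < n then l p else 0)) = kern n (\<lambda>p. int (l p))"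
      by (rule kern_cong) simp
    then show "?F (\<lambda>i. if i < n then l i else 0) = ?F l" by simp
  next
    fix l assume l: "l \<in> compositions n m"
    then show "(\<lambda>i. if i < n then restrict l {..<n} i else 0) = l"
      by (auto simp: compositions_def fun_eq_iff)
    have "l i < L" if "i < n" for i
      using member_le_sum[of i "{..<n}" l] l that assms by (simp add: compositions_def)
    then show "restrict l {..<n} \<in> {l\<in>?E. (\<Sum>i<n. l i) = m}"
      using l by (simp add: compositions_def)
  qed
  also have "fps_nth (of_nat (fact n) * hankel N L n) m = of_nat (fact n) * fps_nth (hankel N L n) m"
    by (simp add: fps_of_nat[symmetric] del: fps_of_nat)
  finally show ?thesis .
qed

lemma of_nat_fact_fps_neq_0: "(of_nat (fact n) :: rat fps) \<noteq> 0"
proof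
  assume "(of_nat (fact n) :: rat fps) = 0"
  then have "fps_nth (fps_const (of_nat (fact n) :: rat)) 0 = 0"
    by (simp only: fps_of_nat fps_zero_nth)
  then show False by simp
qed

lemma hankel_nth_small:
  assumes "m < \<Sum>{..<n}" "m < L"
  shows "fps_nth (hankel N L n) m = 0"
proof -
  have "(of_nat (fact n) :: rat fps) * fps_nth (hankel N L n) m = 0"
    unfolding fact_mult_hankel_nth[OF assms(2)]
    using assms(1) by (intro sum.neutral) (auto simp: compositions_def kern_small)
  then show ?thesis
    using of_nat_fact_fps_neq_0[of n] by (simp only: mult_eq_0_iff) simp
qed

text \<open>Replacing N by n in the weights changes the exponent by a multiple of the sum of the
  entries of \<open>l\<close>, which is constant in a fixed degree; what remains is the character
  formula for n variables.\<close>

lemma hankel_nth: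
  assumes d: "d \<le> n" and L: "d + \<Sum>{..<n} < L"
  shows "fps_nth (hankel N L n) (d + \<Sum>{..<n}) =
    fps_exp (of_int ((\<Sum>p<n. int p * (int p + 1 - 2 * int n)) - 2 * (int N - int n) * int (d + \<Sum>{..<n})) / 2) * fps_nth tau d"
proof -
  let ?C = "compositions n (d + \<Sum>{..<n})"
  let ?K = "(\<Sum>p<n. int p * (int p + 1 - 2 * int n)) - 2 * (int N - int n) * int (d + \<Sum>{..<n})"
  let ?c = "\<lambda>l. fps_const ((kern n (\<lambda>p. int (l p)))\<^sup>2) * fps_exp (of_int (double_content n l) / 2)"
  have e: "(\<Sum>i<n. int (l i) * (int (l i) + 1 - 2 * int N)) = ?K + double_content n l" if "l \<in> ?C" for l
  proof -
    have "int (d + \<Sum>{..<n}) = (\<Sum>i<n. int (l i))"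
      using that by (simp add: compositions_def flip: of_nat_sum)
    then have "?K + double_content n l =
        (\<Sum>i<n. int (l i) * (int (l i) + 1 - 2 * int n)) - 2 * (int N - int n) * (\<Sum>i<n. int (l i))"
      unfolding double_content_def by (simp only:)
    also have "\<dots> = (\<Sum>i<n. int (l i) * (int (l i) + 1 - 2 * int N))"
      unfolding sum_distrib_left sum_subtractf[symmetric]
      by (intro sum.cong refl) (simp add: algebra_simps)
    finally show ?thesis ..
  qed
  have "of_nat (fact n) * fps_nth (hankel N L n) (d + \<Sum>{..<n}) = (\<Sum>l\<in>?C. fps_exp (of_int ?K / 2) * ?c l)"
    unfolding fact_mult_hankel_nth[OF L]
  proof (rule sum.cong[OF refl])
    fix l assume l: "l \<in> ?C"
    show "fps_const ((kern n (\<lambda>p. int (l p)))\<^sup>2) * fps_exp (of_int (\<Sum>i<n. int (l i) * (int (l i) + 1 - 2 * int N)) / 2) =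
        fps_exp (of_int ?K / 2) * ?c l"
      unfolding e[OF l] of_int_add add_divide_distrib fps_exp_add_mult by (simp only: mult_ac)
  qed
  also have "\<dots> = fps_exp (of_int ?K / 2) * (\<Sum>l\<in>?C. ?c l)"
    by (rule sum_distrib_left[symmetric])
  also have "(\<Sum>l\<in>?C. ?c l) = of_nat (fact n) * fps_nth tau d"
  proof (rule fps_ext)
    fix b
    have "fps_nth (\<Sum>l\<in>?C. ?c l) b =
        (\<Sum>l\<in>?C. (kern n (\<lambda>p. int (l p)))\<^sup>2 * (of_int (double_content n l) / 2) ^ b) / fact b"
      by (simp add: fps_sum_nth sum_divide_distrib)
    also have "\<dots> = fps_nth (of_nat (fact n) * fps_nth tau d) b"
      unfolding Cov_eq_sum_kern[OF d, symmetric]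
      by (simp add: tau_def fps_of_nat[symmetric] del: fps_of_nat)
    finally show "fps_nth (\<Sum>l\<in>?C. ?c l) b = \<dots>" .
  qed
  finally have a: "of_nat (fact n) * fps_nth (hankel N L n) (d + \<Sum>{..<n}) =
      of_nat (fact n) * (fps_exp (of_int ?K / 2) * fps_nth tau d)"
    by (simp only: mult_ac)
  show ?thesis
    using a unfolding mult_left_cancel[OF of_nat_fact_fps_neq_0] .
qed

lemma fps_mult_nth_cong:
  assumes "\<And>i. i \<le> m \<Longrightarrow> fps_nth f i = fps_nth f' i" "\<And>i. i \<le> m \<Longrightarrow> fps_nth g i = fps_nth g' i"
  shows "fps_nth (f * g) m = fps_nth (f' * g') m"
  using assms by (simp add: fps_mult_nth)

lemma deriv_u_fps_X_power_mult:
  "deriv_u (fps_X ^ M * g) = fps_X ^ M * (of_nat M * g + deriv_u g)"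
proof -
  have "deriv_u (fps_X ^ M) = of_nat M * fps_X ^ M"
    by (rule fps_ext) (simp add: deriv_u_def fps_of_nat[symmetric] del: fps_of_nat)
  then show ?thesis by (simp add: deriv_u_mult algebra_simps)
qed

lemma deriv_u_const_mult: "deriv_u (fps_const c * g) = fps_const c * deriv_u g"
  by (rule fps_ext) (simp add: deriv_u_def)

text \<open>Multiplication by a power of e^u adds a constant to the logarithmic derivative, and the
  second derivative of the logarithm does not change.\<close>

lemma hirota_fps_X_power_mult:
  "(fps_X ^ M * g) * deriv_u (deriv_u (fps_X ^ M * g)) - (deriv_u (fps_X ^ M * g))\<^sup>2 =
    fps_X ^ (2 * M) * (g * deriv_u (deriv_u g) - (deriv_u g)\<^sup>2)"
proof -
  have d: "deriv_u (of_nat M * g) = of_nat M * deriv_u g"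
    using deriv_u_const_mult[of "of_nat M" g] by (simp add: fps_of_nat)
  have ring: "(A * g) * (A * (M * (M * g + g1) + (M * g1 + g2))) - (A * (M * g + g1))\<^sup>2 =
      (A * A) * (g * g2 - g1\<^sup>2)" for A M g g1 g2 :: "rat fps fps"
    by (simp add: power2_eq_square algebra_simps)
  have X: "fps_X ^ (2 * M) = fps_X ^ M * (fps_X ^ M :: rat fps fps)"
    by (simp only: mult_2 power_add)
  show ?thesis
    unfolding deriv_u_fps_X_power_mult deriv_u_add d X by (rule ring)
qed

lemma shift_u_nth: "fps_nth (shift_u c f) d = fps_exp (of_nat d * c) * fps_nth f d"
  by (simp add: shift_u_def fps_compose_linear fps_exp_power_mult)

lemma toda_tau: "tau * deriv_u (deriv_u tau) - (deriv_u tau)\<^sup>2 = fps_X * (shift_u 1 tau * shift_u (- 1) tau)"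
proof (rule fps_ext)
  fix m
  \<comment> \<open>The coefficient of degree m involves \<open>tau\<close> up to degree m, so the
    sizes k, N = k + 1 and k + 2 of the three determinants are all taken larger than m.\<close>
  define k where "k = Suc m"
  define N where "N = Suc k"
  define M where "M = (\<lambda>n::nat. \<Sum>{..<n})"
  \<comment> \<open>This exceeds every degree \<open>d + M n\<close> with d \<le> n \<le> N +
    1.\<close>
  define L where "L = Suc (Suc N + M (Suc N))"
  define T where "T = (\<lambda>n. fps_shift (M n) (hankel N L n))"
  define E where "E = (\<lambda>n. \<Sum>p<n. int p * (int p + 1 - 2 * int n))"
  have M: "M (Suc n) = n + M n" for n by (simp add: M_def lessThan_Suc)
  have bound: "d + M n < L" if "d \<le> n" "n \<le> Suc N" for d n
  proof -
    have "M n \<le> M (Suc N)" unfolding M_def using that by (intro sum_mono2) auto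
    with that show ?thesis by (simp add: L_def)
  qed
  have hankel: "hankel N L n = fps_X ^ M n * T n" if "n \<le> Suc N" for n
  proof (rule fps_ext)
    fix j
    show "fps_nth (hankel N L n) j = fps_nth (fps_X ^ M n * T n) j"
      using hankel_nth_small[of j n L N] bound[of 0 n] that
      by (simp add: fps_X_power_mult_nth T_def M_def)
  qed
  have T_nth: "fps_nth (T n) d = fps_exp (of_int (E n - 2 * (int N - int n) * int (d + M n)) / 2) * fps_nth tau d"
    if "d \<le> n" "n \<le> Suc N" for n d
    using hankel_nth[OF that(1), of L N] bound[OF that] by (simp add: T_def M_def E_def)
  have exp_nz: "fps_exp c \<noteq> (0 :: rat fps)" for c
  proof
    assume "fps_exp c = (0 :: rat fps)"
    then have "fps_nth (fps_exp c) 0 = (0 :: rat)" by simp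
    then show False by simp
  qed
  \<comment> \<open>The lowest coefficient is an exponential in \<beta>, as \<open>tau\<close> has
    constant term 1.\<close>
  have nz: "hankel N L (Suc N) \<noteq> 0"
    using T_nth[of 0 "Suc N"] by (auto simp: T_def tau_nth_0 exp_nz)
  have toda: "hankel N L N * deriv_u (deriv_u (hankel N L N)) - (deriv_u (hankel N L N))\<^sup>2 =
      hankel N L (Suc N) * hankel N L k"
    unfolding hankel_def N_def
    by (rule hankel_toda[where D = deriv_u, OF deriv_u_add deriv_u_mult deriv_u_moment nz[unfolded hankel_def N_def]])
  have "fps_X ^ (2 * M N) * (T N * deriv_u (deriv_u (T N)) - (deriv_u (T N))\<^sup>2) =
      fps_X ^ (M (Suc N) + M k) * (T (Suc N) * T k)"
  proof -
    have h: "hankel N L N = fps_X ^ M N * T N" "hankel N L (Suc N) = fps_X ^ M (Suc N) * T (Suc N)"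
      "hankel N L k = fps_X ^ M k * T k"
      by (rule hankel, simp add: N_def)+
    show ?thesis
      using toda unfolding h hirota_fps_X_power_mult by (simp only: power_add mult_ac)
  qed
  \<comment> \<open>The staircase degrees on the two sides differ by one; the surplus is the factor
    \<open>fps_X\<close> of the Toda equation.\<close>
  also have "M (Suc N) + M k = Suc (2 * M N)"
    using M[of N] M[of k] by (simp add: N_def)
  also have "fps_X ^ Suc (2 * M N) * (T (Suc N) * T k) = fps_X ^ (2 * M N) * (fps_X * (T (Suc N) * T k))"
    by (simp add: mult_ac)
  finally have T: "T N * deriv_u (deriv_u (T N)) - (deriv_u (T N))\<^sup>2 = fps_X * (T (Suc N) * T k)"
    by (simp del: power_Suc)
  define c0 cp cm :: "rat fps" where "c0 = fps_exp (of_int (E N) / 2)"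
    and "cp = fps_exp (of_int (E (Suc N) + 2 * int (M (Suc N))) / 2)"
    and "cm = fps_exp (of_int (E k - 2 * int (M k)) / 2)"
  have T0: "fps_nth (T N) d = fps_nth (fps_const c0 * tau) d" if "d \<le> m" for d
    using T_nth[of d N] that by (simp add: c0_def N_def k_def)
  have Tp: "fps_nth (T (Suc N)) d = fps_nth (fps_const cp * shift_u 1 tau) d" if "d \<le> m" for d
  proof -
    have "of_int (E (Suc N) - 2 * (int N - int (Suc N)) * int (d + M (Suc N))) / 2 =
        (of_int (E (Suc N) + 2 * int (M (Suc N))) / 2 + of_nat d * 1 :: rat)"
      by (simp add: field_simps)
    then show ?thesis
      using T_nth[of d "Suc N"] that
      by (simp only: fps_mult_left_const_nth shift_u_nth cp_def fps_exp_add_mult mult.assoc)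
        (simp add: N_def k_def)
  qed
  have Tm: "fps_nth (T k) d = fps_nth (fps_const cm * shift_u (- 1) tau) d" if "d \<le> m" for d
  proof -
    have "of_int (E k - 2 * (int N - int k) * int (d + M k)) / 2 =
        (of_int (E k - 2 * int (M k)) / 2 + of_nat d * - 1 :: rat)"
      by (simp add: N_def field_simps)
    then show ?thesis
      using T_nth[of d k] that
      by (simp only: fps_mult_left_const_nth shift_u_nth cm_def fps_exp_add_mult mult.assoc)
        (simp add: N_def k_def)
  qed
  \<comment> \<open>The prefactors independent of d must cancel: their exponents, combined as a
    second difference in n, add up to zero.\<close>
  have c: "cp * cm = c0\<^sup>2"
  proof -
    have E: "E n = (\<Sum>p<n. int p * (int p + 1)) - 2 * int n * int (M n)" for n
      unfolding E_def M_def of_nat_sum sum_distrib_left sum_subtractf[symmetric]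
      by (intro sum.cong refl) (simp add: algebra_simps)
    have "E (Suc N) + 2 * int (M (Suc N)) + (E k - 2 * int (M k)) = E N + E N"
      unfolding E M N_def by (simp add: algebra_simps)
    then have "of_int (E (Suc N) + 2 * int (M (Suc N))) / 2 + of_int (E k - 2 * int (M k)) / 2 =
        (of_int (E N) / 2 + of_int (E N) / 2 :: rat)"
      by (simp only: add_divide_distrib[symmetric] of_int_add[symmetric])
    then show ?thesis
      by (simp only: cp_def cm_def c0_def power2_eq_square fps_exp_add_mult[symmetric])
  qed
  \<comment> \<open>\<open>tau\<close> and the determinants agree up to degree m only, so the
    comparison is made for this one coefficient, with the nonzero factor \<open>c0\<close> squared
    carried along and cancelled at the end.\<close>
  have "c0\<^sup>2 * fps_nth (tau * deriv_u (deriv_u tau) - (deriv_u tau)\<^sup>2) m =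
      fps_nth ((fps_const c0 * tau) * (fps_const c0 * deriv_u (deriv_u tau)) -
        (fps_const c0 * deriv_u tau) * (fps_const c0 * deriv_u tau)) m"
  proof -
    have "(fps_const c0 * tau) * (fps_const c0 * deriv_u (deriv_u tau)) -
        (fps_const c0 * deriv_u tau) * (fps_const c0 * deriv_u tau) =
        fps_const (c0\<^sup>2) * (tau * deriv_u (deriv_u tau) - (deriv_u tau)\<^sup>2)"
      by (simp only: power2_eq_square fps_const_mult[symmetric] right_diff_distrib mult_ac)
    then show ?thesis
      by (simp only: fps_mult_left_const_nth)
  qed
  also have "\<dots> = fps_nth (T N * deriv_u (deriv_u (T N)) - (deriv_u (T N))\<^sup>2) m"
  proof -
    have D: "fps_nth (deriv_u f) i = of_nat i * fps_nth f i" for f :: "rat fps fps" and i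
      by (simp add: deriv_u_def)
    have 1: "fps_nth ((fps_const c0 * tau) * (fps_const c0 * deriv_u (deriv_u tau))) m =
        fps_nth (T N * deriv_u (deriv_u (T N))) m"
      by (rule fps_mult_nth_cong) (simp_all add: T0 D mult_ac)
    have 2: "fps_nth ((fps_const c0 * deriv_u tau) * (fps_const c0 * deriv_u tau)) m =
        fps_nth (deriv_u (T N) * deriv_u (T N)) m"
      by (rule fps_mult_nth_cong) (simp_all add: T0 D mult_ac)
    show ?thesis
      unfolding fps_sub_nth 1 2 power2_eq_square ..
  qed
  also have "\<dots> = fps_nth (fps_X * (T (Suc N) * T k)) m"
    unfolding T ..
  also have "\<dots> = fps_nth (fps_X * ((fps_const cp * shift_u 1 tau) * (fps_const cm * shift_u (- 1) tau))) m"
    by (rule fps_mult_nth_cong[OF refl], rule fps_mult_nth_cong; rule Tp Tm; simp)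
  also have "\<dots> = fps_nth (fps_const (cp * cm) * (fps_X * (shift_u 1 tau * shift_u (- 1) tau))) m"
    unfolding fps_const_mult[symmetric] by (simp only: mult_ac)
  also have "\<dots> = c0\<^sup>2 * fps_nth (fps_X * (shift_u 1 tau * shift_u (- 1) tau)) m"
    unfolding c by (rule fps_mult_left_const_nth)
  finally show "fps_nth (tau * deriv_u (deriv_u tau) - (deriv_u tau)\<^sup>2) m =
      fps_nth (fps_X * (shift_u 1 tau * shift_u (- 1) tau)) m"
    using exp_nz by (simp add: c0_def)
qed

theorem mainTheorem3:
  shows "fls_X_inv * fps_to_fls (deriv_u (deriv_u (log_series tau))) =
         fps_to_fls (shift_u 1 tau * shift_u (- 1) tau / tau\<^sup>2)"
  by (rule toda_log_form[OF toda_tau])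

end
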